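(* Let $S$ be the network generated by $(V,E,\lambda)$. Define \[ \bar n \;=\; 3\,\operatorname{card}(E)+\sum_{e\in E}\left\lceil \frac{5\lambda(e)}{\min_{e'\in E}\lambda(e')}\right\rceil . \] Then for every integer $n\ge \bar n$, the location game $\mathcal L(n,S)$ admits a pure Nash equilibrium.
   Context: Network: $(V,E)$ is a finite connected graph with at least one edge and no vertex of degree $2$; each edge $e$ has a length $\lambda(e)>0$. The network $S$ is the metric measure space obtained by identifying each edge $e=(u,v)$ with a segment of length $\lambda(e)$ joining $u$ and $v$ (glued at common vertices). The measure $\lambda$ on $S$ is one-dimensional length measure, and $d(x,y)$ is the length of a shortest path in $S$ between $x$ and $y$. A vertex of degree $1$ is a leaf. Location game $\mathcal L(n,S)$: there are $n$ players (retailers), $N=\{1,\dots,n\}$. Each player chooses a point $x_i\in S$. Consumers are distributed on $S$ according to $\lambda$, and each consumer shops at a closest occupied location. Ties are resolved as follows. For a set $K$ of occupied locations, let $Y_K$ be the set of points of $S$ equidistant from all locations in $K$ and strictly closer to them than to any other occupied location. The mass $\lambda(Y_K)$ is split equally among the locations in $K$, and the share of each location is split equally among the players located there. The payoff $\rho_i(\boldsymbol x)$ of player $i$ is the total mass of consumers she attracts. A (pure) Nash equilibrium is a profile from which no player can increase her payoff by a unilateral change of location. *)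

theory Defs
  imports "HOL-Analysis.Analysis"
begin

text \<open>
Networks.  The graph has vertex set V (type 'v) and edge set E.  Each (undirected)
edge is listed exactly once, as an ordered pair (a,b) fixing an orientation used
only to parametrise the edge: the point (e,t) with e = (a,b) and 0 <= t <= lam e
is the point of the segment at distance t from a and lam e - t from b.
A vertex has several representatives (one per incident edge, at t = 0 or t = lam e);
representatives of the same point of S are exactly those at distance 0.
\<close>

type_synonym 'v point = "('v \<times> 'v) \<times> real"

definition adj :: "('v \<times> 'v) set \<Rightarrow> 'v \<Rightarrow> 'v \<Rightarrow> bool" where
  "adj E u v \<longleftrightarrow> (u, v) \<in> E \<or> (v, u) \<in> E"

definition elen :: "('v \<times> 'v) set \<Rightarrow> ('v \<times> 'v \<Rightarrow> real) \<Rightarrow> 'v \<Rightarrow> 'v \<Rightarrow> real" where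
  "elen E lam u v = (if (u, v) \<in> E then lam (u, v) else lam (v, u))"

definition is_walk :: "('v \<times> 'v) set \<Rightarrow> 'v \<Rightarrow> 'v \<Rightarrow> 'v list \<Rightarrow> bool" where
  "is_walk E u v ws \<longleftrightarrow> ws \<noteq> [] \<and> hd ws = u \<and> last ws = v \<and>
     (\<forall>i < length ws - 1. adj E (ws ! i) (ws ! (i + 1)))"

definition walk_len :: "('v \<times> 'v) set \<Rightarrow> ('v \<times> 'v \<Rightarrow> real) \<Rightarrow> 'v list \<Rightarrow> real" where
  "walk_len E lam ws = (\<Sum>i < length ws - 1. elen E lam (ws ! i) (ws ! (i + 1)))"

definition vdist :: "('v \<times> 'v) set \<Rightarrow> ('v \<times> 'v \<Rightarrow> real) \<Rightarrow> 'v \<Rightarrow> 'v \<Rightarrow> real" where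
  "vdist E lam u v = Inf {walk_len E lam ws | ws. is_walk E u v ws}"

definition connected_graph :: "'v set \<Rightarrow> ('v \<times> 'v) set \<Rightarrow> bool" where
  "connected_graph V E \<longleftrightarrow> (\<forall>u \<in> V. \<forall>v \<in> V. \<exists>ws. is_walk E u v ws)"

definition degree :: "('v \<times> 'v) set \<Rightarrow> 'v \<Rightarrow> nat" where
  "degree E v = card {e \<in> E. fst e = v \<or> snd e = v}"

definition netpts :: "('v \<times> 'v) set \<Rightarrow> ('v \<times> 'v \<Rightarrow> real) \<Rightarrow> 'v point set" where
  "netpts E lam = {(e, t). e \<in> E \<and> 0 \<le> t \<and> t \<le> lam e}"

definition ends :: "'v point \<Rightarrow> 'v set" where
  "ends p = {fst (fst p), snd (fst p)}"

definition off :: "('v \<times> 'v \<Rightarrow> real) \<Rightarrow> 'v point \<Rightarrow> 'v \<Rightarrow> real" where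
  "off lam p a = (if a = fst (fst p) then snd p else lam (fst p) - snd p)"

text \<open>Shortest-path distance d in S: a shortest path either stays inside the common
edge or leaves the edge of each point through one of its endpoints.\<close>
definition pdist :: "('v \<times> 'v) set \<Rightarrow> ('v \<times> 'v \<Rightarrow> real) \<Rightarrow> 'v point \<Rightarrow> 'v point \<Rightarrow> real" where
  "pdist E lam p q = Min ((if fst p = fst q then {\<bar>snd p - snd q\<bar>} else {}) \<union>
      (\<lambda>(a, b). off lam p a + vdist E lam a b + off lam q b) ` (ends p \<times> ends q))"

text \<open>Share of consumer y attributed to player i in profile x of the n players {1..n}:
if x i is among the closest occupied locations, the consumer is split equally among the
(distinct) closest locations, and the share of a location equally among its players.\<close>
definition share :: "('v \<times> 'v) set \<Rightarrow> ('v \<times> 'v \<Rightarrow> real) \<Rightarrow> nat \<Rightarrow> (nat \<Rightarrow> 'v point)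
    \<Rightarrow> nat \<Rightarrow> 'v point \<Rightarrow> real" where
  "share E lam n x i y =
    (let m = Min ((\<lambda>j. pdist E lam (x j) y) ` {1..n});
         C = {j \<in> {1..n}. pdist E lam (x j) y = m};
         loc = (\<lambda>j. {k \<in> {1..n}. pdist E lam (x j) (x k) = 0})
     in if i \<in> C then 1 / (real (card (loc ` C)) * real (card (loc i))) else 0)"

definition payoff :: "('v \<times> 'v) set \<Rightarrow> ('v \<times> 'v \<Rightarrow> real) \<Rightarrow> nat \<Rightarrow> (nat \<Rightarrow> 'v point)
    \<Rightarrow> nat \<Rightarrow> real" where
  "payoff E lam n x i = (\<Sum>e \<in> E. integral {0..lam e} (\<lambda>t. share E lam n x i (e, t)))"

definition nash_eq :: "('v \<times> 'v) set \<Rightarrow> ('v \<times> 'v \<Rightarrow> real) \<Rightarrow> nat \<Rightarrow> (nat \<Rightarrow> 'v point) \<Rightarrow> bool" where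
  "nash_eq E lam n x \<longleftrightarrow> (\<forall>i \<in> {1..n}. x i \<in> netpts E lam) \<and>
     (\<forall>i \<in> {1..n}. \<forall>y \<in> netpts E lam. payoff E lam n (x(i := y)) i \<le> payoff E lam n x i)"

end

theory Submission
  imports Defs
begin

text \<open>
  Fix a gap size G. On every edge the players stand at consecutive distances G, except for one
  shorter gap in the interior of the edge (possibly 0, so that two players share a location).
  Every vertex of degree d > 1 carries d players, and at distance G/2 from every leaf there is a
  pair of players. A player i earns M/2, where M \<ge> G is the length of the merged gap that i would
  leave behind, or G if i leaves no gap. After i has left, all gaps are at most M, all leaf gaps are
  at most M/2, and every vertex of degree d > 1 still carries d - 1 players. Hence i earns at most
  M/2 in a gap, at most 2 (M/2) / 2 next to another player, and at most d (M/2) / d at a vertex.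

  The number of players is adjusted one at a time: G is decreased until the short gap of some edge
  has length G, where it may be read as a full gap followed by a new short gap of length 0.
\<close>

section \<open>The metric of the network\<close>

text \<open>The obstacle is that distance is global: a consumer on one edge may be reached from far
  away along several routes. Occupied vertices remove this. A shortest path that enters an edge from
  outside can be taken through an endpoint of degree > 1, since a leaf gives no entrance, and such
  an endpoint carries a player even after one player has left. Whoever comes from beyond it is
  farther away than the player standing there. So a player earns only on edges that contain her
  location, and both the upper and the lower payoff bounds become statements about positions on a
  segment. No common payoff level is aimed at: the guaranteed amounts range from G/2 at vertices,
  leaf pairs and coinciding pairs to G between two full gaps. Each player is compared only with the
  gap that she herself would open, so the bound M varies with the player.\<close>

definition vertex_at :: "('v \<times> 'v \<Rightarrow> real) \<Rightarrow> 'v point \<Rightarrow> 'v \<Rightarrow> bool" where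
  "vertex_at lam p v \<longleftrightarrow> v \<in> ends p \<and> off lam p v = 0"

text \<open>Replaces the condition that \<open>pdist\<close> is 0, which is how \<open>share\<close>
  recognises a common location, by a combinatorial test on representatives. On points of the network
  the two agree by \<open>pdist_zero_iff\<close>.\<close>

definition same_pt :: "('v \<times> 'v \<Rightarrow> real) \<Rightarrow> 'v point \<Rightarrow> 'v point \<Rightarrow> bool" where
  "same_pt lam p q \<longleftrightarrow> p = q \<or> (\<exists>v. vertex_at lam p v \<and> vertex_at lam q v)"

abbreviation leaf :: "('v \<times> 'v) set \<Rightarrow> 'v \<Rightarrow> bool" where
  "leaf E v \<equiv> degree E v = 1"

lemma same_pt_sym: "same_pt lam p q \<Longrightarrow> same_pt lam q p"
  by (auto simp: same_pt_def)

lemma off_simps [simp]: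
  "off lam ((a, b), t) a = t"
  "a \<noteq> b \<Longrightarrow> off lam ((a, b), t) b = lam (a, b) - t"
  by (auto simp: off_def)

lemma ends_simps [simp]: "ends ((a, b), t) = {a, b}"
  by (simp add: ends_def)

lemma finite_ends [simp]: "finite (ends p)"
  by (simp add: ends_def)

lemma pdist_le_via:
  "a \<in> ends p \<Longrightarrow> b \<in> ends q \<Longrightarrow> pdist E lam p q \<le> off lam p a + vdist E lam a b + off lam q b"
  unfolding pdist_def by (rule Min_le) auto

lemma pdist_le_same: "pdist E lam (e, s) (e, t) \<le> \<bar>s - t\<bar>"
  unfolding pdist_def by (rule Min_le) auto

lemma pdist_cases:
  obtains "fst p = fst q" "pdist E lam p q = \<bar>snd p - snd q\<bar>"
  | a b where "a \<in> ends p" "b \<in> ends q"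
      "pdist E lam p q = off lam p a + vdist E lam a b + off lam q b"
proof -
  let ?S = "(if fst p = fst q then {\<bar>snd p - snd q\<bar>} else {}) \<union>
      (\<lambda>(a, b). off lam p a + vdist E lam a b + off lam q b) ` (ends p \<times> ends q)"
  have "pdist E lam p q \<in> ?S"
    unfolding pdist_def by (rule Min_in) (auto simp: ends_def)
  then show ?thesis
    using that by (auto split: if_splits)
qed

text \<open>As a function of \<open>t\<close> the distance is a minimum of at most five continuous
  functions: four routes through endpoints and possibly the direct one. This feeds the measurability
  of \<open>share\<close>.\<close>

lemma continuous_pdist: "continuous_on UNIV (\<lambda>t. pdist E lam p (e, t))"
proof -
  obtain a b where e: "e = (a, b)" by (cases e)
  let ?c = "fst (fst p)" and ?d = "snd (fst p)"
  let ?f = "\<lambda>t u v. off lam p u + vdist E lam u v + off lam (e, t) v"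
  have cont: "continuous_on UNIV (\<lambda>t. ?f t u v)" for u v
    unfolding off_def by (cases "v = a") (auto simp: e intro!: continuous_intros)
  have eq: "pdist E lam p (e, t) =
    (if fst p = e then min \<bar>snd p - t\<bar> (min (min (?f t ?c a) (?f t ?c b)) (min (?f t ?d a) (?f t ?d b)))
     else min (min (?f t ?c a) (?f t ?c b)) (min (?f t ?d a) (?f t ?d b)))" for t
  proof -
    have "(\<lambda>(a, b). off lam p a + vdist E lam a b + off lam (e, t) b) ` (ends p \<times> ends (e, t))
       = {?f t ?c a, ?f t ?c b, ?f t ?d a, ?f t ?d b}"
      by (auto simp: ends_def e)
    then show ?thesis unfolding pdist_def by (simp add: min.assoc min.commute min.left_commute)
  qed
  show ?thesis
    unfolding eq by (cases "fst p = e") (simp_all, (intro continuous_intros continuous_on_min cont)+)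
qed

locale network =
  fixes V :: "'v set" and E :: "('v \<times> 'v) set" and lam :: "'v \<times> 'v \<Rightarrow> real"
  assumes finite_V: "finite V" and E_subset: "E \<subseteq> V \<times> V"
    and simple: "(a, b) \<in> E \<Longrightarrow> a \<noteq> b"
    and connected: "connected_graph V E"
    and lam_pos: "e \<in> E \<Longrightarrow> lam e > 0"
begin

lemma finite_E: "finite E"
  using finite_V E_subset by (meson finite_SigmaI finite_subset)

lemma ends_in_V: "p \<in> netpts E lam \<Longrightarrow> ends p \<subseteq> V"
  using E_subset by (auto simp: netpts_def ends_def)

lemma Min_lam:
  assumes "e \<in> E" shows "0 < Min (lam ` E)" "Min (lam ` E) \<le> lam e"
proof -
  have "lam ` E \<noteq> {}" using assms by blast
  then show "0 < Min (lam ` E)" using finite_E lam_pos by (subst Min_gr_iff) auto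
  show "Min (lam ` E) \<le> lam e" using finite_E assms by simp
qed

lemma elen_ge: "adj E u v \<Longrightarrow> Min (lam ` E) \<le> elen E lam u v"
  using Min_lam by (auto simp: adj_def elen_def)

lemma adj_pos: "adj E u v \<Longrightarrow> 0 < Min (lam ` E)"
  using Min_lam by (auto simp: adj_def)

lemma walk_len_nonneg: "is_walk E u v ws \<Longrightarrow> 0 \<le> walk_len E lam ws"
  unfolding walk_len_def
  by (rule sum_nonneg) (auto simp: is_walk_def intro: less_imp_le order.trans[OF less_imp_le[OF adj_pos] elen_ge])

text \<open>Peels off the last edge, because the bounds on \<open>vdist\<close> depend on how a walk
  arrives at its end.\<close>

lemma walk_snoc:
  assumes "is_walk E u v ws" "u \<noteq> v"
  obtains ws' c where "is_walk E u c ws'" "adj E c v"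
    "walk_len E lam ws = walk_len E lam ws' + elen E lam c v"
proof -
  define ws' where "ws' = butlast ws"
  have ws: "ws = ws' @ [v]"
    using assms by (metis append_butlast_last_id is_walk_def ws'_def)
  have ne: "ws' \<noteq> []" using assms ws by (auto simp: is_walk_def)
  then obtain k where len: "length ws' = Suc k" by (cases ws') auto
  have lst: "last ws' = ws' ! k" using ne len by (simp add: last_conv_nth)
  have step: "\<forall>i < length ws'. adj E (ws ! i) (ws ! (i + 1))"
    using assms by (simp add: is_walk_def ws)
  have adj: "adj E (last ws') v"
    using step[rule_format, of k] len lst by (simp add: ws nth_append)
  have "is_walk E u (last ws') ws'"
    unfolding is_walk_def
  proof (intro conjI allI impI)
    show "hd ws' = u" using assms ne by (simp add: is_walk_def ws)
    fix i assume "i < length ws' - 1"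
    then show "adj E (ws' ! i) (ws' ! (i + 1))"
      using step[rule_format, of i] len by (simp add: ws nth_append)
  qed (use ne in auto)
  moreover have "walk_len E lam ws = walk_len E lam ws' + elen E lam (last ws') v"
  proof -
    have "walk_len E lam ws = (\<Sum>i < Suc k. elen E lam (ws ! i) (ws ! (i + 1)))"
      unfolding walk_len_def using len by (simp add: ws)
    also have "\<dots> = (\<Sum>i < k. elen E lam (ws ! i) (ws ! (i + 1))) + elen E lam (last ws') v"
      using len lst by (simp add: ws nth_append)
    also have "(\<Sum>i < k. elen E lam (ws ! i) (ws ! (i + 1))) = walk_len E lam ws'"
      unfolding walk_len_def using len by (intro sum.cong) (auto simp: ws nth_append)
    finally show ?thesis .
  qed
  ultimately show ?thesis using that adj by blast
qed

lemma vdist_le: "is_walk E u v ws \<Longrightarrow> vdist E lam u v \<le> walk_len E lam ws"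
  unfolding vdist_def
  by (rule cInf_lower) (auto intro!: bdd_belowI[of _ 0] walk_len_nonneg)

lemma vdist_ge:
  assumes "u \<in> V" "v \<in> V" "\<And>ws. is_walk E u v ws \<Longrightarrow> c \<le> walk_len E lam ws"
  shows "c \<le> vdist E lam u v"
  unfolding vdist_def
  by (rule cInf_greatest) (use assms connected in \<open>auto simp: connected_graph_def\<close>)

lemma vdist_nonneg: "u \<in> V \<Longrightarrow> v \<in> V \<Longrightarrow> 0 \<le> vdist E lam u v"
  by (rule vdist_ge) (auto intro: walk_len_nonneg)

lemma vdist_self: "u \<in> V \<Longrightarrow> vdist E lam u u = 0"
  using vdist_le[of u u "[u]"] vdist_nonneg[of u u] by (simp add: is_walk_def walk_len_def)

text \<open>Every walk between distinct vertices has a last edge, of length at least the minimum of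
  \<open>lam\<close>. This uniform bound survives the infimum over walks, which positivity of each
  single walk would not.\<close>

lemma vdist_pos:
  assumes "u \<in> V" "v \<in> V" "u \<noteq> v"
  shows "0 < vdist E lam u v"
proof -
  obtain ws where ws: "is_walk E u v ws"
    using assms connected by (auto simp: connected_graph_def)
  have "0 < Min (lam ` E)"
    by (rule walk_snoc[OF ws assms(3)]) (rule adj_pos)
  moreover have "Min (lam ` E) \<le> vdist E lam u v"
  proof (rule vdist_ge)
    fix ws assume "is_walk E u v ws"
    then obtain ws' c where w: "is_walk E u c ws'" "adj E c v"
      "walk_len E lam ws = walk_len E lam ws' + elen E lam c v"
      using assms(3) by (rule walk_snoc)
    then show "Min (lam ` E) \<le> walk_len E lam ws"
      using elen_ge[OF w(2)] walk_len_nonneg[OF w(1)] by simp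
  qed (use assms in auto)
  ultimately show ?thesis by simp
qed

lemma leaf_edge_unique:
  assumes "leaf E b" "e \<in> E" "fst e = b \<or> snd e = b" "f \<in> E" "fst f = b \<or> snd f = b"
  shows "f = e"
proof -
  obtain g where "{e \<in> E. fst e = b \<or> snd e = b} = {g}"
    using assms(1) unfolding degree_def by (auto simp: card_1_singleton_iff)
  then have "e \<in> {g}" "f \<in> {g}" using assms by auto
  then show ?thesis by simp
qed

text \<open>The only edge at the leaf \<open>b\<close> is \<open>e\<close>, so every walk that ends
  in \<open>b\<close> and starts elsewhere traverses \<open>e\<close> last, coming from
  \<open>c\<close>.\<close>

lemma vdist_leaf:
  assumes "leaf E b" "e \<in> E" "e = (b, c) \<or> e = (c, b)" "a \<in> V" "a \<noteq> b"
  shows "vdist E lam a c + lam e \<le> vdist E lam a b"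
proof (rule vdist_ge)
  show "b \<in> V" using assms E_subset by auto
  fix ws assume "is_walk E a b ws"
  from walk_snoc[OF this assms(5)] obtain ws' d where
    w: "is_walk E a d ws'" "adj E d b" "walk_len E lam ws = walk_len E lam ws' + elen E lam d b" .
  have bc: "b \<noteq> c" using assms(2,3) simple by auto
  have be: "fst e = b \<or> snd e = b" using assms(3) by auto
  have uniq: "g = e" if "g \<in> E" "g = (d, b) \<or> g = (b, d)" for g
    using leaf_edge_unique[OF assms(1,2) be that(1)] that(2) by auto
  have "elen E lam d b = lam e"
    using w(2) uniq by (auto simp: adj_def elen_def)
  moreover have "d = c"
    using w(2) uniq[of "(d, b)"] uniq[of "(b, d)"] assms(3) bc unfolding adj_def by blast
  ultimately have "elen E lam d b = lam e \<and> d = c" by simp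
  then show "vdist E lam a c + lam e \<le> walk_len E lam ws"
    using w vdist_le by auto
qed (use assms in auto)

lemma off_nonneg: "p \<in> netpts E lam \<Longrightarrow> 0 \<le> off lam p a"
  by (auto simp: netpts_def off_def)

lemma pdist_nonneg:
  assumes "p \<in> netpts E lam" "q \<in> netpts E lam" shows "0 \<le> pdist E lam p q"
proof (cases rule: pdist_cases[of p q E lam])
  case (2 a b)
  then show ?thesis
    using off_nonneg[OF assms(1), of a] off_nonneg[OF assms(2), of b] 
      vdist_nonneg[OF subsetD[OF ends_in_V[OF assms(1)]] subsetD[OF ends_in_V[OF assms(2)]], of a b]
    by simp
qed simp

text \<open>Both summands are nonnegative and \<open>vdist\<close> vanishes only on the diagonal. In
  use: whoever reaches the vertex \<open>b\<close> at no cost stands on \<open>b\<close>.\<close>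

lemma via_zero:
  assumes "p \<in> netpts E lam" "a \<in> ends p" "b \<in> V" "off lam p a + vdist E lam a b \<le> 0"
  shows "a = b" "vertex_at lam p b"
proof -
  have "a \<in> V" using assms ends_in_V by blast
  then have "0 \<le> vdist E lam a b" "a \<noteq> b \<Longrightarrow> 0 < vdist E lam a b"
    using assms vdist_nonneg vdist_pos by auto
  moreover have "0 \<le> off lam p a" using assms off_nonneg by blast
  ultimately show "a = b" using assms(4) by fastforce
  then show "vertex_at lam p b"
    using assms \<open>0 \<le> off lam p a\<close> \<open>0 \<le> vdist E lam a b\<close> by (auto simp: vertex_at_def)
qed

lemma pdist_zero_iff:
  assumes "p \<in> netpts E lam" "q \<in> netpts E lam"
  shows "pdist E lam p q = 0 \<longleftrightarrow> same_pt lam p q"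
proof
  assume z: "pdist E lam p q = 0"
  show "same_pt lam p q"
  proof (cases rule: pdist_cases[of p q E lam])
    case 1
    then have "p = q" using z by (auto simp: prod_eq_iff)
    then show ?thesis by (simp add: same_pt_def)
  next
    case (2 a b)
    have o: "0 \<le> off lam q b" using assms off_nonneg by blast
    have "b \<in> V" using 2 assms ends_in_V by blast
    then have v: "a = b" "vertex_at lam p b" using via_zero[OF assms(1) 2(1)] 2(3) z o by auto
    have "off lam q b = 0"
      using 2 v z o \<open>b \<in> V\<close> vdist_self by (auto simp: vertex_at_def)
    then show ?thesis using v 2 by (auto simp: same_pt_def vertex_at_def)
  qed
next
  assume "same_pt lam p q"
  then consider "p = q" | v where "vertex_at lam p v" "vertex_at lam q v"
    by (auto simp: same_pt_def)
  then have "pdist E lam p q \<le> 0"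
  proof cases
    case 1
    then show ?thesis using pdist_le_same[of E lam "fst p" "snd p" "snd p"] by simp
  next
    case 2
    then have "v \<in> V" using ends_in_V[OF assms(1)] by (auto simp: vertex_at_def)
    then show ?thesis using pdist_le_via[of v p v q E lam] 2 vdist_self by (auto simp: vertex_at_def)
  qed
  then show "pdist E lam p q = 0" using pdist_nonneg[OF assms] by simp
qed

lemma vertex_at_unique:
  assumes "p \<in> netpts E lam" "vertex_at lam p v" "vertex_at lam p w" shows "v = w"
proof -
  obtain a b t where p: "p = ((a, b), t)" by (metis surj_pair)
  then have "lam (a, b) > 0" "a \<noteq> b" using assms(1) lam_pos simple by (auto simp: netpts_def)
  then show ?thesis using assms p by (auto simp: vertex_at_def)
qed

lemma same_pt_trans:
  assumes "q \<in> netpts E lam" "same_pt lam p q" "same_pt lam q r" shows "same_pt lam p r"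
  using assms(2,3) vertex_at_unique[OF assms(1)] unfolding same_pt_def by metis

lemma same_edge_pos_unique:
  assumes "(e, s) \<in> netpts E lam" "(e, t) \<in> netpts E lam" "same_pt lam (e, s) (e, t)" shows "s = t"
proof -
  obtain a b where e: "e = (a, b)" by (cases e)
  then have "lam (a, b) > 0" "a \<noteq> b" using assms(1) lam_pos simple by (auto simp: netpts_def)
  then show ?thesis using assms e by (auto simp: vertex_at_def same_pt_def)
qed

lemma pdist_le_pos:
  assumes "p \<in> netpts E lam" "same_pt lam p (e, q)" "(e, q) \<in> netpts E lam" "(e, t) \<in> netpts E lam"
  shows "pdist E lam p (e, t) \<le> \<bar>q - t\<bar>"
proof -
  obtain a b where e: "e = (a, b)" by (cases e)
  have ab: "a \<noteq> b" using assms(3) e simple by (auto simp: netpts_def)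
  consider "p = (e, q)" | v where "vertex_at lam p v" "vertex_at lam (e, q) v"
    using assms(2) by (auto simp: same_pt_def)
  then show ?thesis
  proof cases
    case 1
    then show ?thesis by (simp add: pdist_le_same)
  next
    case 2
    then have "v \<in> V" using ends_in_V[OF assms(1)] by (auto simp: vertex_at_def)
    then have "pdist E lam p (e, t) \<le> off lam (e, t) v"
      using pdist_le_via[of v p v "(e, t)" E lam] 2 vdist_self by (auto simp: vertex_at_def e)
    also have "\<dots> \<le> \<bar>q - t\<bar>" using 2 ab e by (auto simp: vertex_at_def)
    finally show ?thesis .
  qed
qed

text \<open>A shortest path never enters an edge through a leaf.\<close>

lemma pdist_nonleaf_cases:
  assumes p: "p \<in> netpts E lam" and y: "(e, t) \<in> netpts E lam"
  obtains "fst p = e" "pdist E lam p (e, t) = \<bar>snd p - t\<bar>"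
  | a b where "a \<in> ends p" "b \<in> ends (e, t)" "\<not> leaf E b"
      "pdist E lam p (e, t) = off lam p a + vdist E lam a b + off lam (e, t) b"
proof (cases rule: pdist_cases[of p "(e, t)" E lam])
  case 1
  then show ?thesis using that(1) by simp
next
  case (2 a b)
  note same_edge = that(1)
  show ?thesis
  proof (cases "leaf E b")
    case False
    then show ?thesis using that(2) 2 by blast
  next
    case leaf: True
    obtain c where e: "e = (b, c) \<or> e = (c, b)" using 2(2) by (cases e) auto
    have eE: "e \<in> E" and t: "0 \<le> t" "t \<le> lam e" using y by (auto simp: netpts_def)
    have bc: "b \<noteq> c" using e eE simple by auto
    have cy: "c \<in> ends (e, t)" using e by auto
    have aV: "a \<in> V" using 2 p ends_in_V by blast
    have cV: "c \<in> V" using cy y ends_in_V by blast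
    have off_sum: "off lam (e, t) b + off lam (e, t) c = lam e"
      using e bc by auto
    have offb: "0 \<le> off lam (e, t) b" using off_nonneg y by blast
    \<comment> \<open>A route through a leaf that is an end of \<open>e\<close> and also of the edge
      of \<open>p\<close>: both points lie on the only edge at that leaf, so the direct segment is
      no longer than the route.\<close>
    have direct: thesis
      if v: "v = b \<or> v = c" and lv: "leaf E v" and av: "v \<in> ends p"
        and le: "off lam p v + off lam (e, t) v \<le> pdist E lam p (e, t)" for v
    proof -
      have "fst p = e"
        using leaf_edge_unique[OF lv eE, of "fst p"] p e v av
        by (auto simp: netpts_def ends_def)
      moreover have "0 \<le> snd p" "snd p \<le> lam e" using p \<open>fst p = e\<close> by (auto simp: netpts_def)
      ultimately have "\<bar>snd p - t\<bar> \<le> off lam p v + off lam (e, t) v"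
        using t e v bc by (auto simp: off_def)
      moreover have "pdist E lam p (e, t) \<le> \<bar>snd p - t\<bar>"
        using pdist_le_same[of E lam e "snd p" t] \<open>fst p = e\<close> by (metis prod.collapse)
      ultimately have "pdist E lam p (e, t) = \<bar>snd p - t\<bar>" using le by linarith
      then show thesis using same_edge \<open>fst p = e\<close> by blast
    qed
    show ?thesis
    proof (cases "a = b")
      case True
      then show ?thesis using direct[of b] 2 leaf vdist_self aV by auto
    next
      case False
      have vl: "vdist E lam a c + lam e \<le> vdist E lam a b"
        using vdist_leaf[OF leaf eE e aV False] .
      have "pdist E lam p (e, t) \<le> off lam p a + vdist E lam a c + off lam (e, t) c"
        using pdist_le_via[OF 2(1) cy] by simp
      then have eq: "pdist E lam p (e, t) = off lam p a + vdist E lam a c + off lam (e, t) c"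
        using 2(3) vl off_sum offb by linarith
      show ?thesis
      proof (cases "leaf E c")
        case False
        then show ?thesis using that(2)[OF 2(1) cy False eq] by blast
      next
        case lc: True
        \<comment> \<open>Both ends of \<open>e\<close> are leaves. If \<open>a\<close> differed
          from both, each of its two distances to them would exceed the other by at least
          \<open>lam e\<close>.\<close>
        have "a = c"
        proof (rule ccontr)
          assume "a \<noteq> c"
          then have "vdist E lam a b + lam e \<le> vdist E lam a c"
            using vdist_leaf[OF lc eE _ aV] e by blast
          then show False using vl lam_pos[OF eE] by linarith
        qed
        then show ?thesis using direct[of c] lc 2 eq vdist_self cV by auto
      qed
    qed
  qed
qed

end

section \<open>Bounds on payoffs\<close>

text \<open>Stated by pairwise comparison instead of equality with \<open>Min\<close>: membership
  becomes a finite combination of inequalities between functions that are continuous along an edge,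
  hence measurable.\<close>

definition closest :: "('v \<times> 'v) set \<Rightarrow> ('v \<times> 'v \<Rightarrow> real) \<Rightarrow> nat \<Rightarrow> (nat \<Rightarrow> 'v point)
    \<Rightarrow> 'v point \<Rightarrow> nat set" where
  "closest E lam n x y = {j \<in> {1..n}. \<forall>k \<in> {1..n}. pdist E lam (x j) y \<le> pdist E lam (x k) y}"

definition colocated :: "('v \<times> 'v) set \<Rightarrow> ('v \<times> 'v \<Rightarrow> real) \<Rightarrow> nat \<Rightarrow> (nat \<Rightarrow> 'v point)
    \<Rightarrow> nat \<Rightarrow> nat set" where
  "colocated E lam n x j = {k \<in> {1..n}. pdist E lam (x j) (x k) = 0}"

lemma share_eq:
  assumes "i \<in> {1..n}"
  shows "share E lam n x i y = (if i \<in> closest E lam n x y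
     then 1 / (real (card (colocated E lam n x ` closest E lam n x y))
               * real (card (colocated E lam n x i))) else 0)"
proof -
  have "{j \<in> {1..n}. pdist E lam (x j) y = Min ((\<lambda>j. pdist E lam (x j) y) ` {1..n})}
      = closest E lam n x y"
    unfolding closest_def
  proof (rule Collect_cong, rule conj_cong)
    fix j assume "j \<in> {1..n}"
    then show "pdist E lam (x j) y = Min ((\<lambda>j. pdist E lam (x j) y) ` {1..n}) \<longleftrightarrow>
        (\<forall>k\<in>{1..n}. pdist E lam (x j) y \<le> pdist E lam (x k) y)"
      by (subst eq_commute, subst Min_eq_iff) auto
  qed simp
  then show ?thesis
    unfolding share_def Let_def colocated_def by simp
qed

lemma share_bounds:
  assumes "i \<in> {1..n}"
  shows "0 \<le> share E lam n x i y" "share E lam n x i y \<le> 1 / real (card (colocated E lam n x i))"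
proof -
  let ?A = "card (colocated E lam n x ` closest E lam n x y)"
  let ?B = "card (colocated E lam n x i)"
  show "0 \<le> share E lam n x i y" using assms by (simp add: share_eq)
  show "share E lam n x i y \<le> 1 / real ?B"
  \<comment> \<open>If \<open>?B\<close> is 0, both sides are 0, since division by 0 yields
    0.\<close>
  proof (cases "i \<in> closest E lam n x y \<and> ?B > 0")
    case True
    have "finite (closest E lam n x y)" by (simp add: closest_def)
    then have "?A \<noteq> 0" using True by auto
    then have "1 * real ?B \<le> real ?A * real ?B" by (intro mult_right_mono) auto
    then show ?thesis using True assms by (simp add: share_eq frac_le)
  qed (use assms in \<open>auto simp: share_eq\<close>)
qed

text \<open>The share depends on \<open>t\<close> only through the set of closest players. This set
  takes finitely many values, each on a Borel set, so the share is a bounded simple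
  function.\<close>

lemma share_integrable:
  assumes "i \<in> {1..n}"
  shows "(\<lambda>t. share E lam n x i (e, t)) integrable_on {0..L}"
proof -
  define d where "d j t = pdist E lam (x j) (e, t)" for j t
  define H where "H K = (if i \<in> K then 1 / (real (card (colocated E lam n x ` K))
               * real (card (colocated E lam n x i))) else 0)" for K
  define C where "C t = closest E lam n x (e, t)" for t
  have [measurable]: "d j \<in> borel_measurable borel" for j
    unfolding d_def by (intro borel_measurable_continuous_onI continuous_pdist)
  have C: "{t. C t = K} \<in> sets borel" if "K \<in> Pow {1..n}" for K
  proof -
    have eq: "{t. C t = K} = {t \<in> space borel. \<forall>j\<in>{1..n}. j \<in> K \<longleftrightarrow> (\<forall>k\<in>{1..n}. d j t \<le> d k t)}"
      using that unfolding C_def closest_def d_def by auto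
    show ?thesis unfolding eq by measurable
  qed
  have sh: "share E lam n x i (e, t) = (\<Sum>K\<in>Pow {1..n}. H K * indicator {t. C t = K} t)" for t
  proof -
    have "(\<Sum>K\<in>Pow {1..n}. H K * indicator {t. C t = K} t) = (\<Sum>K\<in>Pow {1..n}. if K = C t then H K else 0)"
      by (rule sum.cong) (auto simp: indicator_def)
    also have "\<dots> = H (C t)"
      by (subst sum.delta) (auto simp: C_def closest_def)
    finally show ?thesis using assms by (simp add: share_eq H_def C_def)
  qed
  have "(\<lambda>t. \<Sum>K\<in>Pow {1..n}. H K * indicator {t. C t = K} t) \<in> borel_measurable borel"
    using C by (intro borel_measurable_sum borel_measurable_times borel_measurable_indicator) auto
  then have "(\<lambda>t. share E lam n x i (e, t)) \<in> borel_measurable borel"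
    by (simp add: sh)
  then have "(\<lambda>t. share E lam n x i (e, t)) \<in> borel_measurable (lebesgue_on {0..L})"
    by (intro measurable_restrict_space1 measurable_completion) simp
  then show ?thesis
  proof (rule measurable_bounded_by_integrable_imp_integrable)
    show "(\<lambda>t. 1 / real (card (colocated E lam n x i))) integrable_on {0..L}"
      by (rule integrable_const_ivl)
  qed (simp_all add: share_bounds[OF assms])
qed

lemma integral_le_const_interval:
  fixes f :: "real \<Rightarrow> real"
  assumes "f integrable_on {0..L}" "0 \<le> \<alpha>" "\<alpha> \<le> \<beta>" "\<beta> \<le> L"
    and "\<And>t. t \<in> {0..L} \<Longrightarrow> f t \<le> (if t \<in> {\<alpha>..\<beta>} then c else 0)"
  shows "integral {0..L} f \<le> c * (\<beta> - \<alpha>)"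
proof -
  have "((\<lambda>t. c) has_integral (c * (\<beta> - \<alpha>))) {\<alpha>..\<beta>}"
    using has_integral_const_real[of c \<alpha> \<beta>] assms(3) by (simp add: mult.commute)
  then have "((\<lambda>t. if t \<in> {\<alpha>..\<beta>} then c else 0) has_integral (c * (\<beta> - \<alpha>))) {0..L}"
    by (subst has_integral_restrict) (use assms in auto)
  then show ?thesis
    using assms(1,5) by (meson has_integral_le integrable_integral)
qed

text \<open>The lower bound \<open>c\<close> is asked for on the open interval only: its ends will
  typically be midpoints between neighbouring locations, where a tie may lower the share.\<close>

lemma integral_ge_const_interval:
  fixes f :: "real \<Rightarrow> real"
  assumes "f integrable_on {0..L}" "0 \<le> \<alpha>" "\<alpha> \<le> \<beta>" "\<beta> \<le> L"
    and "\<And>t. t \<in> {0..L} \<Longrightarrow> 0 \<le> f t" "\<And>t. t \<in> {\<alpha><..<\<beta>} \<Longrightarrow> c \<le> f t"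
  shows "c * (\<beta> - \<alpha>) \<le> integral {0..L} f"
proof -
  have sub: "{\<alpha>..\<beta>} \<subseteq> {0..L}" using assms by auto
  have int: "f integrable_on {\<alpha>..\<beta>}"
    using integrable_on_subinterval[OF assms(1) sub] .
  have "c * (\<beta> - \<alpha>) = integral {\<alpha>..\<beta>} (\<lambda>t. c)"
    using assms(3) by simp
  also have "\<dots> = integral {\<alpha><..<\<beta>} (\<lambda>t. c)"
    by (rule integral_open_interval_real)
  also have "\<dots> \<le> integral {\<alpha><..<\<beta>} f"
    by (rule integral_le) (use assms int in \<open>auto simp: integrable_on_open_interval_real\<close>)
  also have "\<dots> = integral {\<alpha>..\<beta>} f"
    by (rule integral_open_interval_real[symmetric])
  also have "\<dots> \<le> integral {0..L} f"
    by (rule integral_subset_le) (use sub int assms in auto)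
  finally show ?thesis .
qed

text \<open>The inequality at \<open>p (Suc k)\<close> is strict here, the one at \<open>p k\<close>
  is strict in \<open>seq_bracket_left\<close>: a neighbour different from \<open>s\<close> is
  wanted on one side, even if \<open>s\<close> is itself one of the positions.\<close>

lemma seq_bracket_right:
  fixes p :: "nat \<Rightarrow> real"
  assumes "p 0 \<le> s" "s < p K" shows "\<exists>k<K. p k \<le> s \<and> s < p (Suc k)"
  using assms(2)
proof (induction K)
  case (Suc K)
  then show ?case by (cases "s < p K") (auto simp: less_Suc_eq)
qed (use assms in auto)

lemma seq_bracket_left:
  fixes p :: "nat \<Rightarrow> real"
  assumes "p 0 < s" "s \<le> p K" shows "\<exists>k<K. p k < s \<and> s \<le> p (Suc k)"
  using assms(2)
proof (induction K)
  case (Suc K)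
  then show ?case by (cases "s \<le> p K") (auto simp: less_Suc_eq)
qed (use assms in auto)

lemma closer_imp_le_midpoint: "s < q \<Longrightarrow> \<bar>s - t\<bar> \<le> \<bar>q - t\<bar> \<Longrightarrow> t \<le> (s + q) / (2::real)"
  by (auto simp: abs_if split: if_splits)

lemma closer_imp_ge_midpoint: "q < s \<Longrightarrow> \<bar>s - t\<bar> \<le> \<bar>q - t\<bar> \<Longrightarrow> (q + s) / 2 \<le> (t::real)"
  by (auto simp: abs_if split: if_splits)

section \<open>Cells of a position on an edge with small gaps\<close>

context network
begin

text \<open>The chain \<open>p\<close> is existential because removing a player changes the list of
  occupied positions; repetitions are allowed. \<open>same_pt\<close> lets a vertex be occupied by a
  player represented on another edge. The bound for a leaf gap is \<open>M / 2\<close>: a deviator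
  next to its only neighbour captures almost all of it, whereas between two players half a gap is
  the most.\<close>

definition gaps_le :: "(nat \<Rightarrow> 'v point) \<Rightarrow> nat set \<Rightarrow> real \<Rightarrow> 'v \<times> 'v \<Rightarrow> bool" where
  "gaps_le x J M e \<longleftrightarrow> (\<exists>K p. (\<forall>k<K. p k \<le> p (Suc k) \<and> p (Suc k) \<le> p k + M) \<and>
     (\<forall>k\<le>K. 0 \<le> p k \<and> p k \<le> lam e \<and> (\<exists>j\<in>J. same_pt lam (x j) (e, p k))) \<and>
     (p 0 = 0 \<or> leaf E (fst e) \<and> p 0 \<le> M / 2) \<and>
     (p K = lam e \<or> leaf E (snd e) \<and> lam e - p K \<le> M / 2))"

text \<open>The closed Voronoi cell of the position \<open>s\<close> within \<open>e\<close>,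
  against the positions of \<open>J\<close> on \<open>e\<close>; competitors located off
  \<open>e\<close> are ignored. It contains every consumer of \<open>e\<close> that a deviator at
  \<open>s\<close> can win.\<close>

definition cell :: "(nat \<Rightarrow> 'v point) \<Rightarrow> nat set \<Rightarrow> 'v \<times> 'v \<Rightarrow> real \<Rightarrow> real set" where
  "cell x J e s = {t \<in> {0..lam e}. \<forall>j\<in>J. \<forall>q\<in>{0..lam e}.
     same_pt lam (x j) (e, q) \<longrightarrow> \<bar>s - t\<bar> \<le> \<bar>q - t\<bar>}"

text \<open>If an occupied position lies to the right of \<open>s\<close>, there is one at distance
  at most \<open>M\<close>, and the midpoint ends the cell after at most \<open>M / 2\<close>.
  Otherwise at most a piece of a leaf gap remains. This covers the case that \<open>s\<close> itself
  is occupied.\<close>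

lemma cell_right:
  assumes "gaps_le x J M e" "0 \<le> M" "s \<in> {0..lam e}"
  obtains \<beta> where "s \<le> \<beta>" "\<beta> \<le> lam e" "\<beta> \<le> s + M / 2" "\<And>t. t \<in> cell x J e s \<Longrightarrow> t \<le> \<beta>"
proof -
  obtain K p where p: "\<forall>k<K. p k \<le> p (Suc k) \<and> p (Suc k) \<le> p k + M"
     "\<forall>k\<le>K. 0 \<le> p k \<and> p k \<le> lam e \<and> (\<exists>j\<in>J. same_pt lam (x j) (e, p k))"
     "p 0 = 0 \<or> leaf E (fst e) \<and> p 0 \<le> M / 2"
     "p K = lam e \<or> leaf E (snd e) \<and> lam e - p K \<le> M / 2"
    using assms(1) unfolding gaps_le_def by blast
  note result = that
  have mid: thesis if k: "k \<le> K" "s < p k" "p k \<le> s + M" for k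
  proof (rule result)
    show "t \<le> (s + p k) / 2" if "t \<in> cell x J e s" for t
      using that k p(2) by (intro closer_imp_le_midpoint) (auto simp: cell_def)
    show "(s + p k) / 2 \<le> lam e" using p(2) k assms(3) by force
  qed (use k in auto)
  consider "s < p 0" | "p 0 \<le> s" "s < p K" | "p K \<le> s" by linarith
  then show thesis
  proof cases
    case 1
    then show ?thesis using mid[of 0] p(3) assms by auto
  next
    case 2
    then obtain k where "k < K" "p k \<le> s" "s < p (Suc k)" using seq_bracket_right by blast
    then show ?thesis using mid[of "Suc k"] p(1) by force
  next
    case 3
    show ?thesis
      by (rule that[of "lam e"]) (use 3 assms p(4) in \<open>auto simp: cell_def\<close>)
  qed
qed

lemma cell_left:
  assumes "gaps_le x J M e" "0 \<le> M" "s \<in> {0..lam e}"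
  obtains \<alpha> where "\<alpha> \<le> s" "0 \<le> \<alpha>" "s - M / 2 \<le> \<alpha>" "\<And>t. t \<in> cell x J e s \<Longrightarrow> \<alpha> \<le> t"
proof -
  obtain K p where p: "\<forall>k<K. p k \<le> p (Suc k) \<and> p (Suc k) \<le> p k + M"
     "\<forall>k\<le>K. 0 \<le> p k \<and> p k \<le> lam e \<and> (\<exists>j\<in>J. same_pt lam (x j) (e, p k))"
     "p 0 = 0 \<or> leaf E (fst e) \<and> p 0 \<le> M / 2"
     "p K = lam e \<or> leaf E (snd e) \<and> lam e - p K \<le> M / 2"
    using assms(1) unfolding gaps_le_def by blast
  note result = that
  have mid: thesis if k: "k \<le> K" "p k < s" "s - M \<le> p k" for k
  proof (rule result)
    show "(p k + s) / 2 \<le> t" if "t \<in> cell x J e s" for t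
      using that k p(2) by (intro closer_imp_ge_midpoint) (auto simp: cell_def)
    show "0 \<le> (p k + s) / 2" using p(2) k assms(3) by force
  qed (use k in auto)
  consider "p K < s" | "p 0 < s" "s \<le> p K" | "s \<le> p 0" by linarith
  then show thesis
  proof cases
    case 1
    then show ?thesis using mid[of K] p(4) assms by auto
  next
    case 2
    then obtain k where "k < K" "p k < s" "s \<le> p (Suc k)" using seq_bracket_left by blast
    then show ?thesis using mid[of k] p(1) by force
  next
    case 3
    show ?thesis
      by (rule that[of 0]) (use 3 assms p(3) in \<open>auto simp: cell_def\<close>)
  qed
qed

text \<open>With no competitor at \<open>s\<close>, its two neighbours bound the same gap, and the
  two midpoints are half that gap apart wherever \<open>s\<close> lies; adding the one-sided bounds
  would give only \<open>M\<close>. In a leaf gap the cell stays inside the gap.\<close>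

lemma cell_unoccupied:
  assumes "gaps_le x J M e" "0 \<le> M" "s \<in> {0..lam e}"
    and free: "\<And>j. j \<in> J \<Longrightarrow> \<not> same_pt lam (x j) (e, s)"
  obtains \<alpha> \<beta> where "0 \<le> \<alpha>" "\<alpha> \<le> \<beta>" "\<beta> \<le> lam e" "\<beta> - \<alpha> \<le> M / 2" "cell x J e s \<subseteq> {\<alpha>..\<beta>}"
proof -
  obtain K p where p: "\<forall>k<K. p k \<le> p (Suc k) \<and> p (Suc k) \<le> p k + M"
     "\<forall>k\<le>K. 0 \<le> p k \<and> p k \<le> lam e \<and> (\<exists>j\<in>J. same_pt lam (x j) (e, p k))"
     "p 0 = 0 \<or> leaf E (fst e) \<and> p 0 \<le> M / 2"
     "p K = lam e \<or> leaf E (snd e) \<and> lam e - p K \<le> M / 2"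
    using assms(1) unfolding gaps_le_def by blast
  have ne: "p k \<noteq> s" if "k \<le> K" for k using p(2) free that by blast
  have right: "t \<le> (s + p k) / 2" if "k \<le> K" "s < p k" "t \<in> cell x J e s" for k t
    using that p(2) by (intro closer_imp_le_midpoint) (auto simp: cell_def)
  have left: "(p k + s) / 2 \<le> t" if "k \<le> K" "p k < s" "t \<in> cell x J e s" for k t
    using that p(2) by (intro closer_imp_ge_midpoint) (auto simp: cell_def)
  have bd: "0 \<le> p k" "p k \<le> lam e" if "k \<le> K" for k using p(2) that by auto
  consider "s < p 0" | "p 0 \<le> s" "s < p K" | "p K < s" using ne[of K] by fastforce
  then show thesis
  proof cases
    case 1
    show ?thesis
      by (rule that[of 0 "(s + p 0) / 2"])
        (use 1 assms(3) p(3) bd[of 0] right[of 0] in \<open>auto simp: cell_def\<close>)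
  next
    case 2
    then obtain k where k: "k < K" "p k \<le> s" "s < p (Suc k)" using seq_bracket_right by blast
    then have "p k < s" using ne[of k] by auto
    moreover have "p (Suc k) \<le> p k + M" using p(1) k by blast
    ultimately show ?thesis
      by (intro that[of "(p k + s) / 2" "(s + p (Suc k)) / 2"])
        (use k bd[of k] bd[of "Suc k"] assms(3) left[of k] right[of "Suc k"] in \<open>auto simp: field_simps\<close>)
  next
    case 3
    show ?thesis
      by (rule that[of "(p K + s) / 2" "lam e"])
        (use 3 assms(3) p(4) bd[of K] left[of K] in \<open>auto simp: cell_def field_simps\<close>)
  qed
qed

lemma vertex_at_same_pt:
  assumes "(e, q) \<in> netpts E lam" "same_pt lam p (e, q)" "vertex_at lam (e, q) v"
  shows "vertex_at lam p v"
  using assms vertex_at_unique[OF assms(1)] unfolding same_pt_def by metis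

lemma gaps_le_vertex_occupied:
  assumes "gaps_le x J M e" "e \<in> E" "v \<in> ends (e, t)" "\<not> leaf E v"
  obtains j where "j \<in> J" "vertex_at lam (x j) v"
proof -
  obtain K :: nat and p :: "nat \<Rightarrow> real" where p:
     "\<forall>k\<le>K. 0 \<le> p k \<and> p k \<le> lam e \<and> (\<exists>j\<in>J. same_pt lam (x j) (e, p k))"
     "p 0 = 0 \<or> leaf E (fst e) \<and> p 0 \<le> M / 2"
     "p K = lam e \<or> leaf E (snd e) \<and> lam e - p K \<le> M / 2"
    using assms(1) unfolding gaps_le_def by blast
  obtain a b where e: "e = (a, b)" by (cases e)
  have ab: "a \<noteq> b" using assms(2) e simple by auto
  obtain k where k: "k \<le> K" "vertex_at lam (e, p k) v"
  proof (cases "v = a")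
    case True
    then show ?thesis using that[of 0] p(2) assms(4) e by (auto simp: vertex_at_def)
  next
    case False
    then show ?thesis using that[of K] p(3) assms(3,4) e ab by (auto simp: vertex_at_def)
  qed
  have "(e, p k) \<in> netpts E lam" using p(1) k assms(2) by (auto simp: netpts_def)
  then show thesis using p(1) k that vertex_at_same_pt by blast
qed

section \<open>Upper bound on the payoff of a deviation\<close>

lemma pdist_le_off:
  assumes "p \<in> netpts E lam" "vertex_at lam p v" "v \<in> ends q"
  shows "pdist E lam p q \<le> off lam q v"
proof -
  have "v \<in> V" using ends_in_V[OF assms(1)] assms(2) by (auto simp: vertex_at_def)
  then show ?thesis
    using pdist_le_via[of v p v q E lam] assms vdist_self by (auto simp: vertex_at_def)
qed

lemma end_position:
  assumes "e \<in> E" "b \<in> ends (e, t)" "t \<in> {0..lam e}"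
  obtains s where "s \<in> {0..lam e}" "s = 0 \<or> s = lam e" "vertex_at lam (e, s) b" "off lam (e, t) b = \<bar>s - t\<bar>"
proof -
  obtain a c where e: "e = (a, c)" by (cases e)
  have "a \<noteq> c" using assms(1) e simple by auto
  moreover have "0 < lam (a, c)" using assms(1) e lam_pos by auto
  ultimately show thesis
    using assms e that[of 0] that[of "lam e"] by (auto simp: vertex_at_def)
qed

text \<open>A path from outside enters \<open>e\<close> at an end \<open>b\<close> that is not a
  leaf, and one of the remaining players stands on \<open>b\<close>. For the deviator to be closest,
  her way to \<open>b\<close> must cost nothing, so she stands on \<open>b\<close> herself and has a
  position on \<open>e\<close>.\<close>

lemma closest_deviator:
  assumes x: "\<And>j. j \<in> {1..n} \<Longrightarrow> x j \<in> netpts E lam" and y: "y \<in> netpts E lam"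
    and i: "i \<in> {1..n}" and e: "e \<in> E" and t: "t \<in> {0..lam e}"
    and dense: "gaps_le x ({1..n} - {i}) M e"
    and cl: "i \<in> closest E lam n (x(i := y)) (e, t)"
  obtains s where "s \<in> {0..lam e}" "same_pt lam y (e, s)" "t \<in> cell x ({1..n} - {i}) e s"
proof -
  have et: "(e, t) \<in> netpts E lam" using e t by (auto simp: netpts_def)
  have le: "pdist E lam y (e, t) \<le> pdist E lam (x j) (e, t)" if "j \<in> {1..n} - {i}" for j
  proof -
    have "pdist E lam ((x(i := y)) i) (e, t) \<le> pdist E lam ((x(i := y)) j) (e, t)"
      using cl that unfolding closest_def by blast
    then show ?thesis using that by simp
  qed
  note result = that
  have fin: thesis if s: "s \<in> {0..lam e}" "same_pt lam y (e, s)" "\<bar>s - t\<bar> \<le> pdist E lam y (e, t)" for s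
  proof (rule result[OF s(1,2)])
    have "\<bar>s - t\<bar> \<le> \<bar>q - t\<bar>"
      if "j \<in> {1..n} - {i}" "q \<in> {0..lam e}" "same_pt lam (x j) (e, q)" for j q
    proof -
      have "pdist E lam (x j) (e, t) \<le> \<bar>q - t\<bar>"
        by (rule pdist_le_pos) (use x that e et in \<open>auto simp: netpts_def\<close>)
      then show ?thesis using le[OF that(1)] s(3) by linarith
    qed
    then show "t \<in> cell x ({1..n} - {i}) e s" using t by (auto simp: cell_def)
  qed
  show thesis
  proof (cases rule: pdist_nonleaf_cases[OF y et])
    case 1
    then have "y = (e, snd y)" by (metis prod.collapse)
    then show ?thesis
      using fin[of "snd y"] 1 y by (auto simp: netpts_def same_pt_def)
  next
    case (2 a b)
    obtain j where j: "j \<in> {1..n} - {i}" "vertex_at lam (x j) b"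
      using gaps_le_vertex_occupied[OF dense e 2(2,3)] by blast
    have bV: "b \<in> V" using 2 et ends_in_V by blast
    have "pdist E lam y (e, t) \<le> off lam (e, t) b"
      using pdist_le_off[of "x j" b "(e, t)"] le[OF j(1)] j x 2 by fastforce
    then have z: "off lam y a + vdist E lam a b \<le> 0" using 2 by simp
    have v: "a = b" "vertex_at lam y b" using via_zero[OF y 2(1) bV z] by auto
    have "pdist E lam y (e, t) = off lam (e, t) b"
      using 2(4) v vdist_self[OF bV] by (auto simp: vertex_at_def)
    moreover obtain s where "s \<in> {0..lam e}" "vertex_at lam (e, s) b" "off lam (e, t) b = \<bar>s - t\<bar>"
      using end_position[OF e 2(2) t] by metis
    ultimately show ?thesis using fin[of s] v by (auto simp: same_pt_def)
  qed
qed

lemma deviation_integral_le: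
  assumes x: "\<And>j. j \<in> {1..n} \<Longrightarrow> x j \<in> netpts E lam" and y: "y \<in> netpts E lam"
    and i: "i \<in> {1..n}" and e: "e \<in> E" and dense: "gaps_le x ({1..n} - {i}) M e"
    and s: "same_pt lam y (e, s)" "s \<in> {0..lam e}"
    and ab: "0 \<le> \<alpha>" "\<alpha> \<le> \<beta>" "\<beta> \<le> lam e" "cell x ({1..n} - {i}) e s \<subseteq> {\<alpha>..\<beta>}"
  shows "integral {0..lam e} (\<lambda>t. share E lam n (x(i := y)) i (e, t))
    \<le> 1 / real (card (colocated E lam n (x(i := y)) i)) * (\<beta> - \<alpha>)"
proof (rule integral_le_const_interval[OF share_integrable[OF i] ab(1-3)])
  fix t assume t: "t \<in> {0..lam e}"
  show "share E lam n (x(i := y)) i (e, t)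
    \<le> (if t \<in> {\<alpha>..\<beta>} then 1 / real (card (colocated E lam n (x(i := y)) i)) else 0)"
  proof (cases "i \<in> closest E lam n (x(i := y)) (e, t)")
    case True
    then obtain s' where s': "s' \<in> {0..lam e}" "same_pt lam y (e, s')" "t \<in> cell x ({1..n} - {i}) e s'"
      using closest_deviator[OF x y i e t dense] by blast
    have "s' = s"
      by (rule same_edge_pos_unique[of e])
        (use s' s e same_pt_trans[OF y same_pt_sym] in \<open>auto simp: netpts_def\<close>)
    then have "t \<in> {\<alpha>..\<beta>}" using s' ab by blast
    then show ?thesis using share_bounds(2)[OF i] by simp
  next
    case False
    then show ?thesis using i by (simp add: share_eq)
  qed
qed

lemma deviation_integral_zero:
  assumes x: "\<And>j. j \<in> {1..n} \<Longrightarrow> x j \<in> netpts E lam" and y: "y \<in> netpts E lam"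
    and i: "i \<in> {1..n}" and e: "e \<in> E" and dense: "gaps_le x ({1..n} - {i}) M e"
    and s: "\<And>s. s \<in> {0..lam e} \<Longrightarrow> \<not> same_pt lam y (e, s)"
  shows "integral {0..lam e} (\<lambda>t. share E lam n (x(i := y)) i (e, t)) = 0"
proof -
  have "share E lam n (x(i := y)) i (e, t) = 0" if t: "t \<in> {0..lam e}" for t
  proof (cases "i \<in> closest E lam n (x(i := y)) (e, t)")
    case True
    then show ?thesis using closest_deviator[OF x y i e t dense] s by metis
  next
    case False
    then show ?thesis using i by (simp add: share_eq)
  qed
  then show ?thesis by (metis (no_types, lifting) integral_cong integral_0)
qed

lemma card_colocated_ge:
  assumes x: "\<And>j. j \<in> {1..n} \<Longrightarrow> x j \<in> netpts E lam" and y: "y \<in> netpts E lam"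
    and i: "i \<in> {1..n}"
  shows "Suc (card {j \<in> {1..n} - {i}. same_pt lam y (x j)}) \<le> card (colocated E lam n (x(i := y)) i)"
proof -
  let ?A = "{j \<in> {1..n} - {i}. same_pt lam y (x j)}"
  have "same_pt lam y y" by (simp add: same_pt_def)
  then have "insert i ?A \<subseteq> colocated E lam n (x(i := y)) i"
    using pdist_zero_iff[OF y y] pdist_zero_iff[OF y x] i by (auto simp: colocated_def)
  then have "card (insert i ?A) \<le> card (colocated E lam n (x(i := y)) i)"
    by (intro card_mono) (auto simp: colocated_def)
  then show ?thesis by simp
qed

text \<open>Only the edges in \<open>S\<close>, those that contain \<open>y\<close>, contribute.
  There can be several only at a vertex that is not a leaf, and there each contributes a one-sided
  cell. A location at a leaf is treated like any other point of its single edge.\<close>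

lemma deviation_payoff_le:
  assumes x: "\<And>j. j \<in> {1..n} \<Longrightarrow> x j \<in> netpts E lam" and y: "y \<in> netpts E lam"
    and i: "i \<in> {1..n}" and M: "0 \<le> M"
    and dense: "\<And>e. e \<in> E \<Longrightarrow> gaps_le x ({1..n} - {i}) M e"
    and crowd: "\<And>v. \<not> leaf E v \<Longrightarrow> degree E v \<le> Suc (card {j \<in> {1..n} - {i}. vertex_at lam (x j) v})"
  shows "payoff E lam n (x(i := y)) i \<le> M / 2"
proof -
  define c where "c = 1 / real (card (colocated E lam n (x(i := y)) i))"
  define f where "f e = integral {0..lam e} (\<lambda>t. share E lam n (x(i := y)) i (e, t))" for e
  define S where "S = {e \<in> E. \<exists>s\<in>{0..lam e}. same_pt lam y (e, s)}"
  let ?J = "{1..n} - {i}"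
  have cge: "Suc (card {j \<in> ?J. same_pt lam y (x j)}) \<le> card (colocated E lam n (x(i := y)) i)"
    by (rule card_colocated_ge) (use x y i in auto)
  have c0: "0 \<le> c" by (simp add: c_def)
  have "payoff E lam n (x(i := y)) i = sum f E" by (simp add: payoff_def f_def)
  also have "\<dots> = sum f S"
    by (rule sum.mono_neutral_right[OF finite_E])
      (use deviation_integral_zero[OF x y i _ dense] in \<open>auto simp: S_def f_def\<close>)
  finally have pay: "payoff E lam n (x(i := y)) i = sum f S" .
  have f_le: "f e \<le> c * (\<beta> - \<alpha>)"
    if "e \<in> E" "same_pt lam y (e, s)" "s \<in> {0..lam e}" "0 \<le> \<alpha>" "\<alpha> \<le> \<beta>" "\<beta> \<le> lam e"
      "cell x ?J e s \<subseteq> {\<alpha>..\<beta>}" for e s \<alpha> \<beta>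
    unfolding f_def c_def using deviation_integral_le[OF x y i _ dense] that by blast
  show ?thesis
  proof (cases "\<exists>v. vertex_at lam y v \<and> \<not> leaf E v")
    case True
    then obtain v where v: "vertex_at lam y v" "\<not> leaf E v" by blast
    have fS: "f e \<le> c * (M / 2) \<and> (fst e = v \<or> snd e = v)" if "e \<in> S" for e
    proof -
      obtain s where s: "s \<in> {0..lam e}" "same_pt lam y (e, s)" and e: "e \<in> E"
        using \<open>e \<in> S\<close> by (auto simp: S_def)
      have es: "vertex_at lam (e, s) v"
        using vertex_at_unique[OF y v(1)] s(2) v(1) unfolding same_pt_def by metis
      then have inc: "fst e = v \<or> snd e = v" by (auto simp: vertex_at_def ends_def)
      have "s = 0 \<or> s = lam e" using es by (auto simp: vertex_at_def off_def split: if_splits)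
      then have "f e \<le> c * (M / 2)"
      proof
        assume "s = 0"
        obtain \<beta> where "s \<le> \<beta>" "\<beta> \<le> lam e" "\<beta> \<le> s + M / 2" "\<And>t. t \<in> cell x ?J e s \<Longrightarrow> t \<le> \<beta>"
          using cell_right[OF dense[OF e] M s(1)] by blast
        then have "f e \<le> c * (\<beta> - 0) \<and> \<beta> \<le> M / 2"
          using \<open>s = 0\<close> by (intro conjI f_le[OF e s(2,1)]) (auto simp: cell_def)
        then show ?thesis using c0 by (metis diff_zero mult_left_mono order_trans)
      next
        assume "s = lam e"
        obtain \<alpha> where "\<alpha> \<le> s" "0 \<le> \<alpha>" "s - M / 2 \<le> \<alpha>" "\<And>t. t \<in> cell x ?J e s \<Longrightarrow> \<alpha> \<le> t"
          using cell_left[OF dense[OF e] M s(1)] by blast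
        then have "f e \<le> c * (lam e - \<alpha>) \<and> lam e - \<alpha> \<le> M / 2"
          using \<open>s = lam e\<close> by (intro conjI f_le[OF e s(2,1)]) (auto simp: cell_def)
        then show ?thesis using c0 by (metis mult_left_mono order_trans)
      qed
      then show ?thesis using inc by blast
    qed
    have "S \<subseteq> {e \<in> E. fst e = v \<or> snd e = v}" using fS by (auto simp: S_def)
    then have "card S \<le> degree E v"
      unfolding degree_def using finite_E by (intro card_mono) auto
    moreover have "sum f S \<le> real (card S) * (c * (M / 2))"
      using fS by (intro sum_bounded_above) blast
    moreover have "degree E v \<le> card (colocated E lam n (x(i := y)) i)"
    proof -
      have "card {j \<in> ?J. vertex_at lam (x j) v} \<le> card {j \<in> ?J. same_pt lam y (x j)}"
        by (rule card_mono) (use v in \<open>auto simp: same_pt_def\<close>)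
      then show ?thesis using crowd[OF v(2)] cge by linarith
    qed
    \<comment> \<open>\<open>c\<close> is one over the number of players at \<open>y\<close>, which
      is at least \<open>degree E v\<close> and hence at least \<open>card S\<close>: the number of
      edges cancels against the number of sharers.\<close>
    ultimately have "real (card S) * c \<le> 1" "sum f S \<le> (real (card S) * c) * (M / 2)"
      unfolding c_def by (auto simp: divide_le_eq)
    then show ?thesis using pay M
      by (smt (verit) mult_left_le_one_le mult_right_mono mult_1 divide_nonneg_nonneg)
  next
    case False
    obtain g s where yg: "y = (g, s)" by (cases y)
    have g: "g \<in> E" "s \<in> {0..lam g}" using y yg by (auto simp: netpts_def)
    have sy: "same_pt lam y (g, s)" by (simp add: yg same_pt_def)
    have "e = g" if "e \<in> S" for e
    proof -
      obtain r where r: "r \<in> {0..lam e}" "same_pt lam y (e, r)" and e: "e \<in> E"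
        using \<open>e \<in> S\<close> by (auto simp: S_def)
      then consider "y = (e, r)" | w where "vertex_at lam y w" "vertex_at lam (e, r) w"
        by (auto simp: same_pt_def)
      then show ?thesis
      proof cases
        case 1
        then show ?thesis using yg by simp
      next
        case 2
        then have "leaf E w" using False by blast
        moreover have "fst g = w \<or> snd g = w" "fst e = w \<or> snd e = w"
          using 2 unfolding yg vertex_at_def ends_def by auto
        ultimately show ?thesis using leaf_edge_unique g(1) e by blast
      qed
    qed
    then have "S = {g}" using g sy by (auto simp: S_def)
    then have pay': "payoff E lam n (x(i := y)) i = f g" using pay by simp
    show ?thesis
    proof (cases "\<exists>j\<in>?J. same_pt lam (x j) (g, s)")
      case True
      then have "card {j \<in> ?J. same_pt lam y (x j)} \<noteq> 0"
        using yg by (auto intro: same_pt_sym)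
      then have "2 \<le> card (colocated E lam n (x(i := y)) i)" using cge by linarith
      then have c2: "c \<le> 1 / 2" unfolding c_def by (simp add: divide_le_eq)
      obtain \<beta> where b: "s \<le> \<beta>" "\<beta> \<le> lam g" "\<beta> \<le> s + M / 2" "\<And>t. t \<in> cell x ?J g s \<Longrightarrow> t \<le> \<beta>"
        using cell_right[OF dense[OF g(1)] M g(2)] by blast
      obtain \<alpha> where a: "\<alpha> \<le> s" "0 \<le> \<alpha>" "s - M / 2 \<le> \<alpha>" "\<And>t. t \<in> cell x ?J g s \<Longrightarrow> \<alpha> \<le> t"
        using cell_left[OF dense[OF g(1)] M g(2)] by blast
      have "f g \<le> c * (\<beta> - \<alpha>)"
        by (rule f_le[OF g(1) sy g(2)]) (use a b in auto)
      also have "\<dots> \<le> 1 / 2 * M"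
        by (rule mult_mono) (use c2 a b in auto)
      finally show ?thesis using pay' by simp
    next
      case False
      then obtain \<alpha> \<beta> where ab: "0 \<le> \<alpha>" "\<alpha> \<le> \<beta>" "\<beta> \<le> lam g" "\<beta> - \<alpha> \<le> M / 2" "cell x ?J g s \<subseteq> {\<alpha>..\<beta>}"
        using cell_unoccupied[OF dense[OF g(1)] M g(2)] by blast
      have "c \<le> 1" unfolding c_def using cge by (simp add: divide_le_eq)
      have "f g \<le> c * (\<beta> - \<alpha>)"
        by (rule f_le[OF g(1) sy g(2)]) (use ab in auto)
      also have "\<dots> \<le> 1 * (M / 2)"
        by (rule mult_mono) (use \<open>c \<le> 1\<close> ab in auto)
      finally show ?thesis using pay' by simp
    qed
  qed
qed

text \<open>On each edge of \<open>F\<close> the open interval is territory where the location of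
  \<open>i\<close> beats every other location that has a position on this edge. Players elsewhere
  have to enter through an occupied end and are beaten as well, so the territory is divided only
  among the players at the location of \<open>i\<close>.\<close>

lemma payoff_ge:
  assumes x: "\<And>j. j \<in> {1..n} \<Longrightarrow> x j \<in> netpts E lam" and i: "i \<in> {1..n}"
    and occ: "\<And>e v. e \<in> E \<Longrightarrow> v \<in> {fst e, snd e} \<Longrightarrow> \<not> leaf E v \<Longrightarrow> \<exists>j\<in>{1..n}. vertex_at lam (x j) v"
    and F: "F \<subseteq> E"
    and s: "\<And>e. e \<in> F \<Longrightarrow> s e \<in> {0..lam e} \<and> same_pt lam (x i) (e, s e)"
    and lr: "\<And>e. e \<in> F \<Longrightarrow> 0 \<le> l e \<and> l e \<le> r e \<and> r e \<le> lam e"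
    and near: "\<And>e t j q. e \<in> F \<Longrightarrow> t \<in> {l e<..<r e} \<Longrightarrow> j \<in> {1..n} \<Longrightarrow> q \<in> {0..lam e} \<Longrightarrow>
        same_pt lam (x j) (e, q) \<Longrightarrow> q \<noteq> s e \<Longrightarrow> \<bar>s e - t\<bar> < \<bar>q - t\<bar>"
  shows "(\<Sum>e\<in>F. r e - l e) / real (card {j \<in> {1..n}. same_pt lam (x i) (x j)}) \<le> payoff E lam n x i"
proof -
  let ?W = "{j \<in> {1..n}. same_pt lam (x i) (x j)}"
  have col: "colocated E lam n x j = {k \<in> {1..n}. same_pt lam (x j) (x k)}" if "j \<in> {1..n}" for j
    unfolding colocated_def using pdist_zero_iff[OF x x] that by auto
  have col_eq: "colocated E lam n x j = ?W" if "j \<in> ?W" for j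
    using that col[of j] same_pt_trans[OF x[OF i]] same_pt_trans[OF x, of j] same_pt_sym by blast
  have share: "1 / real (card ?W) \<le> share E lam n x i (e, t)"
    if e: "e \<in> F" and t: "t \<in> {l e<..<r e}" for e t
  proof -
    have eE: "e \<in> E" using e F by blast
    have t': "t \<in> {0..lam e}" using t lr[OF e] by auto
    have et: "(e, t) \<in> netpts E lam" using eE t' by (auto simp: netpts_def)
    have es: "(e, s e) \<in> netpts E lam" using eE s[OF e] by (auto simp: netpts_def)
    have di: "pdist E lam (x i) (e, t) \<le> \<bar>s e - t\<bar>"
      using pdist_le_pos[OF x[OF i] _ es et] s[OF e] by blast
    have iW: "i \<in> ?W" using i by (simp add: same_pt_def)
    have far: "\<bar>s e - t\<bar> \<le> pdist E lam (x j) (e, t) \<and> (j \<notin> ?W \<longrightarrow> \<bar>s e - t\<bar> < pdist E lam (x j) (e, t))"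
      if j: "j \<in> {1..n}" for j
    proof -
      have atW: "j \<in> ?W" if "same_pt lam (x j) (e, s e)"
        using same_pt_trans[OF es] s[OF e] that same_pt_sym j by blast
      have ne: "\<bar>s e - t\<bar> < \<bar>q - t\<bar>" if "q \<in> {0..lam e}" "same_pt lam (x j) (e, q)" "j \<notin> ?W" for q
        using near[OF e t j(1) that(1,2)] that atW by metis
      show ?thesis
      proof (cases rule: pdist_nonleaf_cases[OF x[OF j] et])
        case 1
        then have xj: "x j = (e, snd (x j))" by (metis prod.collapse)
        then have sj: "snd (x j) \<in> {0..lam e}" "same_pt lam (x j) (e, snd (x j))"
          using x[OF j] by (auto simp: netpts_def same_pt_def)
        then have "\<bar>s e - t\<bar> \<le> \<bar>snd (x j) - t\<bar>"
          using near[OF e t j(1) sj] by (cases "snd (x j) = s e") auto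
        then show ?thesis using ne[OF sj] 1 by auto
      next
        case (2 a b)
        have bV: "b \<in> V" using 2 et ends_in_V by blast
        obtain q where q: "q \<in> {0..lam e}" "vertex_at lam (e, q) b" "off lam (e, t) b = \<bar>q - t\<bar>"
          using end_position[OF eE 2(2) t'] by metis
        \<comment> \<open>The player on \<open>b\<close> may be at the location of \<open>i\<close>
          itself. Then \<open>q = s e\<close>, only the weak inequality is available, and strictness
          has to come from the cost of reaching \<open>b\<close>.\<close>
        obtain k where k: "k \<in> {1..n}" "vertex_at lam (x k) b"
          using occ[OF eE _ 2(3)] 2(2) by (auto simp: ends_def)
        then have "same_pt lam (x k) (e, q)" using q by (auto simp: same_pt_def)
        then have le: "\<bar>s e - t\<bar> \<le> \<bar>q - t\<bar>"
          using near[OF e t k(1) q(1)] by (cases "q = s e") auto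
        have nn: "0 \<le> off lam (x j) a + vdist E lam a b"
          using off_nonneg[OF x[OF j]] vdist_nonneg[OF _ bV] ends_in_V[OF x[OF j]] 2(1)
          by (simp add: subsetD)
        show ?thesis
        proof (cases "off lam (x j) a + vdist E lam a b \<le> 0")
          case True
          then have "vertex_at lam (x j) b" using via_zero[OF x[OF j] 2(1) bV] by blast
          then have "same_pt lam (x j) (e, q)" using q by (auto simp: same_pt_def)
          then have "j \<notin> ?W \<longrightarrow> \<bar>s e - t\<bar> < \<bar>q - t\<bar>" using ne[OF q(1)] by blast
          then show ?thesis using le nn 2(4) q(3) by linarith
        next
          case False
          then show ?thesis using le 2(4) q(3) by linarith
        qed
      qed
    qed
    have icl: "i \<in> closest E lam n x (e, t)"
      unfolding closest_def using far di i by (auto intro: order_trans[OF di])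
    have sub: "closest E lam n x (e, t) \<subseteq> ?W"
    proof
      fix j assume j: "j \<in> closest E lam n x (e, t)"
      then have "j \<in> {1..n}" "pdist E lam (x j) (e, t) \<le> pdist E lam (x i) (e, t)"
        using i by (auto simp: closest_def)
      then have "pdist E lam (x j) (e, t) \<le> \<bar>s e - t\<bar>" using di by linarith
      then show "j \<in> ?W" using far[OF \<open>j \<in> {1..n}\<close>] by linarith
    qed
    have "colocated E lam n x ` closest E lam n x (e, t) = {?W}"
      using sub icl col_eq by blast
    then show ?thesis using icl col_eq[OF iW] by (simp add: share_eq[OF i])
  qed
  have "(\<Sum>e\<in>F. r e - l e) / real (card ?W) = (\<Sum>e\<in>F. 1 / real (card ?W) * (r e - l e))"
    by (simp add: sum_divide_distrib)
  also have "\<dots> \<le> (\<Sum>e\<in>F. integral {0..lam e} (\<lambda>t. share E lam n x i (e, t)))"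
  proof (rule sum_mono)
    fix e assume "e \<in> F"
    then show "1 / real (card ?W) * (r e - l e) \<le> integral {0..lam e} (\<lambda>t. share E lam n x i (e, t))"
      using lr share
      by (intro integral_ge_const_interval share_integrable[OF i] share_bounds(1)[OF i]) auto
  qed
  also have "\<dots> \<le> payoff E lam n x i"
    unfolding payoff_def
    by (rule sum_mono2[OF finite_E F])
      (use share_bounds(1)[OF i] share_integrable[OF i] in \<open>auto intro!: integral_nonneg\<close>)
  finally show ?thesis .
qed

end

section \<open>Evenly spaced profiles\<close>

lemma dist_less_right: "q \<le> l \<Longrightarrow> l \<le> s \<Longrightarrow> q \<noteq> s \<Longrightarrow> (l + s) / 2 < t \<Longrightarrow> \<bar>s - t\<bar> < \<bar>q - (t::real)\<bar>"
  by (auto simp: abs_if)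

lemma dist_less_left: "r \<le> q \<Longrightarrow> s \<le> r \<Longrightarrow> q \<noteq> s \<Longrightarrow> t < (s + r) / 2 \<Longrightarrow> \<bar>s - t\<bar> < \<bar>q - (t::real)\<bar>"
  by (auto simp: abs_if)

text \<open>\<open>z\<close> is the reciprocal of the gap size, which makes the constraints linear:
  \<open>lam e * z - c e - real (m e)\<close> is the short gap in units of a full one. Edges that
  fill up simultaneously cause no conflict: only one count is raised, and the others keep a short
  gap of full length, which the non-strict upper bound allows, until a later step.\<close>

lemma spacing_exists:
  fixes lam c :: "'e \<Rightarrow> real" and m :: "'e \<Rightarrow> nat"
  assumes "finite E" "E \<noteq> {}" and lam: "\<And>e. e \<in> E \<Longrightarrow> 0 < lam e" and "0 < z"
    and fit: "\<And>e. e \<in> E \<Longrightarrow> real (m e) \<le> lam e * z - c e \<and> lam e * z - c e \<le> real (m e) + 1"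
    and "sum m E \<le> N"
  shows "\<exists>z'>0. \<exists>m'. sum m' E = N \<and> (\<forall>e\<in>E. m e \<le> m' e \<and>
     real (m' e) \<le> lam e * z' - c e \<and> lam e * z' - c e \<le> real (m' e) + 1)"
  using \<open>sum m E \<le> N\<close>
proof (induction N rule: dec_induct)
  case base
  then show ?case using assms by blast
next
  case (step N)
  then obtain z' m' where z': "0 < z'" "sum m' E = N" and
    m': "\<And>e. e \<in> E \<Longrightarrow> m e \<le> m' e \<and> real (m' e) \<le> lam e * z' - c e \<and> lam e * z' - c e \<le> real (m' e) + 1"
    by blast
  \<comment> \<open>The value of \<open>z\<close> at which the short gap of \<open>e\<close> becomes
    a full one; the smallest of these is reached first.\<close>
  define h where "h e = (real (m' e) + 1 + c e) / lam e" for e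
  obtain e0 where e0: "e0 \<in> E" "\<And>e. e \<in> E \<Longrightarrow> h e0 \<le> h e"
    using ex_is_arg_min_if_finite[OF assms(1,2), of h] by (auto simp: is_arg_min_linorder)
  define z2 where "z2 = h e0"
  have "z' \<le> h e" if "e \<in> E" for e
    using m'[OF that] lam[OF that] by (simp add: h_def field_simps)
  then have zz: "z' \<le> z2" using e0 by (simp add: z2_def)
  define m2 where "m2 = m'(e0 := Suc (m' e0))"
  have "sum m2 E = Suc N"
    using assms(1) e0(1) z'(2) by (simp add: m2_def sum.remove[of E e0])
  moreover have "m e \<le> m2 e \<and> real (m2 e) \<le> lam e * z2 - c e \<and> lam e * z2 - c e \<le> real (m2 e) + 1"
    if e: "e \<in> E" for e
  proof -
    have up: "lam e * z2 - c e \<le> real (m' e) + 1"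
      using e0(2)[OF e] lam[OF e] by (simp add: z2_def h_def field_simps)
    have "lam e * z' \<le> lam e * z2" using zz lam[OF e] by simp
    then have low: "real (m' e) \<le> lam e * z2 - c e" using m'[OF e] by linarith
    have "lam e0 * z2 - c e0 = real (m' e0) + 1"
      using lam[OF e0(1)] by (simp add: z2_def h_def)
    then show ?thesis using up low m'[OF e] by (auto simp: m2_def)
  qed
  ultimately show ?case using z'(1) zz by (intro exI[of _ z2] conjI exI[of _ m2]) auto
qed

text \<open>\<open>m e\<close> is the number of full gaps on \<open>e\<close>. The two
  \<open>fits\<close> bounds say that the short gap has length between 0 and \<open>G\<close> once
  \<open>G / 2\<close> has been reserved at each leaf end.\<close>

locale spaced_network = network V E lam
  for V :: "'v set" and E :: "('v \<times> 'v) set" and lam :: "'v \<times> 'v \<Rightarrow> real" +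
  fixes G :: real and m :: "'v \<times> 'v \<Rightarrow> nat"
  assumes G_pos: "0 < G" and m_ge: "e \<in> E \<Longrightarrow> 2 \<le> m e"
    and fits: "e \<in> E \<Longrightarrow> real (m e) * G \<le> lam e - real (of_bool (leaf E (fst e)) + of_bool (leaf E (snd e))) * (G / 2)"
      "e \<in> E \<Longrightarrow> lam e - real (of_bool (leaf E (fst e)) + of_bool (leaf E (snd e))) * (G / 2) \<le> (real (m e) + 1) * G"
begin

definition margin :: "'v \<Rightarrow> real" where
  "margin v = (if leaf E v then G / 2 else 0)"

text \<open>The short gap \<open>rest\<close> lies between positions m - 1 and m, away from both ends because 2 \<le> m.\<close>

definition pos :: "'v \<times> 'v \<Rightarrow> nat \<Rightarrow> real" where
  "pos e k = (if k < m e then margin (fst e) + real k * G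
     else lam e - margin (snd e) - real (m e + 1 - k) * G)"

definition rest :: "'v \<times> 'v \<Rightarrow> real" where
  "rest e = lam e - margin (fst e) - margin (snd e) - real (m e) * G"

lemma rest: "e \<in> E \<Longrightarrow> 0 \<le> rest e" "e \<in> E \<Longrightarrow> rest e \<le> G"
  using fits[of e] by (auto simp: rest_def margin_def field_simps split: if_splits)

lemma margin_nonneg: "0 \<le> margin v"
  using G_pos by (simp add: margin_def)

lemma pos_0: "e \<in> E \<Longrightarrow> pos e 0 = margin (fst e)"
  using m_ge[of e] by (simp add: pos_def)

lemma pos_last: "pos e (Suc (m e)) = lam e - margin (snd e)"
  by (simp add: pos_def)

lemma pos_Suc:
  assumes "e \<in> E" "k \<le> m e"
  shows "pos e (Suc k) = pos e k + (if Suc k = m e then rest e else G)"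
proof -
  consider "Suc k < m e" | "Suc k = m e" | "k = m e" using assms by linarith
  then show ?thesis
  proof cases
    case 2
    then have "real (m e) = real k + 1" by linarith
    then have "real (m e) * G = real k * G + G" by (simp add: algebra_simps)
    then show ?thesis using 2 by (simp add: pos_def rest_def)
  qed (auto simp: pos_def algebra_simps)
qed

lemma pos_Suc_bounds:
  assumes "e \<in> E" "k \<le> m e"
  shows "pos e k \<le> pos e (Suc k)" "pos e (Suc k) \<le> pos e k + G"
  using pos_Suc[OF assms] rest[OF assms(1)] G_pos by auto

lemma pos_mono:
  assumes "e \<in> E" "j \<le> k" "k \<le> Suc (m e)" shows "pos e j \<le> pos e k"
  using assms(2,3)
proof (induction k rule: dec_induct)
  case (step k)
  then show ?case using pos_Suc_bounds(1)[OF assms(1), of k] by simp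
qed simp

lemma pos_1: "e \<in> E \<Longrightarrow> pos e 1 = margin (fst e) + G"
  using pos_Suc[of e 0] pos_0[of e] m_ge[of e] by simp

lemma pos_m: "pos e (m e) = lam e - margin (snd e) - G"
  by (simp add: pos_def)

lemma pos_bounds:
  assumes "e \<in> E" "k \<le> Suc (m e)" shows "0 \<le> pos e k" "pos e k \<le> lam e"
  using pos_mono[OF assms(1), of 0 k] pos_mono[OF assms(1), of k "Suc (m e)"] assms
    pos_0 pos_last margin_nonneg[of "fst e"] margin_nonneg[of "snd e"] by auto

text \<open>The flag \<open>True\<close> marks the second player of a pair next to a leaf. A vertex of degree
  d > 1 needs no such copies: each of its d edges contributes one player.\<close>

definition players :: "(('v \<times> 'v) \<times> nat \<times> bool) set" where
  "players = (SIGMA e:E. {..Suc (m e)} \<times> {False} \<union> (if leaf E (fst e) then {(0, True)} else {})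
     \<union> (if leaf E (snd e) then {(Suc (m e), True)} else {}))"

definition spot :: "('v \<times> 'v) \<times> nat \<times> bool \<Rightarrow> 'v point" where
  "spot a = (fst a, pos (fst a) (fst (snd a)))"

lemma players_iff:
  "(e, k, b) \<in> players \<longleftrightarrow> e \<in> E \<and> k \<le> Suc (m e) \<and>
     (b \<longrightarrow> k = 0 \<and> leaf E (fst e) \<or> k = Suc (m e) \<and> leaf E (snd e))"
  by (cases b) (auto simp: players_def)

lemma finite_players: "finite players"
  unfolding players_def using finite_E by (intro finite_SigmaI) auto

lemma card_players:
  "card players = (\<Sum>e\<in>E. m e + 2 + of_bool (leaf E (fst e)) + of_bool (leaf E (snd e)))"
proof -
  have "card ({..Suc (m e)} \<times> {False} \<union> (if leaf E (fst e) then {(0, True)} else {})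
     \<union> (if leaf E (snd e) then {(Suc (m e), True)} else {}))
     = m e + 2 + of_bool (leaf E (fst e)) + of_bool (leaf E (snd e))" for e
    by (subst card_Un_disjoint, simp, simp, force)+ (auto simp: card_cartesian_product)
  then show ?thesis
    unfolding players_def using finite_E by (subst card_SigmaI) auto
qed

lemma spot_netpts: "a \<in> players \<Longrightarrow> spot a \<in> netpts E lam"
  using pos_bounds by (cases a) (auto simp: players_iff spot_def netpts_def)

text \<open>The first and the last gap are full, so only the extreme indices can reach an end of the
  edge, and at a leaf the margin \<open>G / 2\<close> keeps even these away.\<close>

lemma vertex_at_pos:
  assumes e: "e \<in> E" "k \<le> Suc (m e)" and v: "vertex_at lam (e, pos e k) v"
  shows "\<not> leaf E v" "k = 0 \<and> fst e = v \<or> k = Suc (m e) \<and> snd e = v"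
proof -
  obtain a b where ab: "e = (a, b)" by (cases e)
  have "a \<noteq> b" using e ab simple by auto
  then consider "v = a" "pos e k = 0" | "v = b" "pos e k = lam e"
    using v ab by (auto simp: vertex_at_def)
  then have "\<not> leaf E v \<and> (k = 0 \<and> fst e = v \<or> k = Suc (m e) \<and> snd e = v)"
  proof cases
    case 1
    have "k = 0"
    proof (rule ccontr)
      assume "k \<noteq> 0"
      then have "pos e 1 \<le> pos e k" using e by (intro pos_mono) auto
      then show False using pos_1[OF e(1)] margin_nonneg[of "fst e"] G_pos 1 by linarith
    qed
    then show ?thesis using 1 pos_0[OF e(1)] ab G_pos by (auto simp: margin_def)
  next
    case 2
    have "k = Suc (m e)"
    proof (rule ccontr)
      assume "k \<noteq> Suc (m e)"
      then have "pos e k \<le> pos e (m e)" using e by (intro pos_mono) auto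
      then show False using pos_m[of e] margin_nonneg[of "snd e"] G_pos 2 by linarith
    qed
    then show ?thesis using 2 pos_last[of e] ab G_pos by (auto simp: margin_def)
  qed
  then show "\<not> leaf E v" "k = 0 \<and> fst e = v \<or> k = Suc (m e) \<and> snd e = v" by auto
qed

lemma vertex_at_end:
  assumes "e \<in> E" "fst e = v \<or> snd e = v" "\<not> leaf E v"
  shows "vertex_at lam (e, pos e (if fst e = v then 0 else Suc (m e))) v"
  using assms pos_0[of e] pos_last[of e]
  by (auto simp: vertex_at_def margin_def off_def ends_def)

text \<open>A player listed under another edge can meet \<open>e\<close> only at a vertex that is
  not a leaf, and there \<open>e\<close> has an extreme position of its own. So \<open>pos e\<close>
  lists all occupied positions of \<open>e\<close>.\<close>

lemma spot_on_edge:
  assumes "a \<in> players" "e \<in> E" "same_pt lam (spot a) (e, q)"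
  obtains k where "k \<le> Suc (m e)" "q = pos e k"
proof -
  obtain e' k' b where a: "a = (e', k', b)" by (metis surj_pair)
  have a': "e' \<in> E" "k' \<le> Suc (m e')" using assms(1) by (auto simp: a players_iff)
  consider "(e', pos e' k') = (e, q)" | v where "vertex_at lam (e', pos e' k') v" "vertex_at lam (e, q) v"
    using assms(3) by (auto simp: a spot_def same_pt_def)
  then show thesis
  proof cases
    case 1
    then show ?thesis using that a' by auto
  next
    case 2
    have v: "\<not> leaf E v" using vertex_at_pos(1)[OF a' 2(1)] .
    obtain c d where cd: "e = (c, d)" by (cases e)
    have "c \<noteq> d" using assms(2) cd simple by auto
    then consider "v = c" "q = 0" | "v = d" "q = lam e"
      using 2(2) cd by (auto simp: vertex_at_def)
    then show ?thesis
    proof cases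
      case 1
      then show ?thesis using that[of 0] pos_0[OF assms(2)] v cd by (auto simp: margin_def)
    next
      case 2
      then show ?thesis using that[of "Suc (m e)"] pos_last[of e] v cd by (auto simp: margin_def)
    qed
  qed
qed

end

section \<open>The profile and what remains after one player has left\<close>

locale spaced_profile = spaced_network V E lam G m
  for V :: "'v set" and E :: "('v \<times> 'v) set" and lam :: "'v \<times> 'v \<Rightarrow> real" and G m +
  fixes n :: nat and \<phi> :: "nat \<Rightarrow> ('v \<times> 'v) \<times> nat \<times> bool"
  assumes bij: "bij_betw \<phi> {1..n} players"
begin

definition x :: "nat \<Rightarrow> 'v point" where
  "x j = spot (\<phi> j)"

lemma \<phi>_players: "j \<in> {1..n} \<Longrightarrow> \<phi> j \<in> players"
  using bij by (auto simp: bij_betw_def)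

lemma player_at:
  assumes "a \<in> players" obtains j where "j \<in> {1..n}" "\<phi> j = a"
  using assms bij by (metis bij_betw_imp_surj_on imageE)

lemma x_netpts: "j \<in> {1..n} \<Longrightarrow> x j \<in> netpts E lam"
  by (simp add: x_def \<phi>_players spot_netpts)

lemma card_players_with: "card {j \<in> {1..n}. P (\<phi> j)} = card {a \<in> players. P a}"
proof (rule bij_betw_same_card)
  have "\<phi> ` {j \<in> {1..n}. P (\<phi> j)} = {a \<in> players. P a}"
    using bij by (subst bij_betw_imp_surj_on[OF bij, symmetric]) blast
  moreover have "inj_on \<phi> {j \<in> {1..n}. P (\<phi> j)}"
    by (rule inj_on_subset[of _ "{1..n}"]) (use bij in \<open>auto simp: bij_betw_def\<close>)
  ultimately show "bij_betw \<phi> {j \<in> {1..n}. P (\<phi> j)} {a \<in> players. P a}"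
    by (simp add: bij_betw_def)
qed

lemma card_colocated_players:
  assumes "i \<in> {1..n}"
  shows "card {j \<in> {1..n}. same_pt lam (x i) (x j)} = card {a \<in> players. same_pt lam (spot (\<phi> i)) (spot a)}"
  unfolding x_def by (rule card_players_with)

lemma players_at_vertex:
  assumes "\<not> leaf E v"
  shows "{a \<in> players. vertex_at lam (spot a) v}
    = (\<lambda>e. (e, if fst e = v then 0 else Suc (m e), False)) ` {e \<in> E. fst e = v \<or> snd e = v}"
    (is "?L = ?R")
proof (rule set_eqI, rule iffI)
  fix a assume a: "a \<in> ?L"
  obtain e k b where a_eq: "a = (e, k, b)" by (metis surj_pair)
  have e: "e \<in> E" "k \<le> Suc (m e)" and
    b: "b \<longrightarrow> k = 0 \<and> leaf E (fst e) \<or> k = Suc (m e) \<and> leaf E (snd e)"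
    using a by (auto simp: a_eq players_iff)
  have ne: "fst e \<noteq> snd e" using e simple[of "fst e" "snd e"] by auto
  have "k = 0 \<and> fst e = v \<or> k = Suc (m e) \<and> snd e = v"
    using vertex_at_pos(2)[OF e] a by (auto simp: a_eq spot_def)
  then show "a \<in> ?R" using b e ne assms by (auto simp: a_eq)
next
  fix a assume "a \<in> ?R"
  then obtain e where e: "e \<in> E" "fst e = v \<or> snd e = v"
    and a: "a = (e, if fst e = v then 0 else Suc (m e), False)" by blast
  then show "a \<in> ?L"
    using vertex_at_end[OF e assms] by (simp add: spot_def players_iff)
qed

lemma card_players_at_vertex:
  assumes "\<not> leaf E v"
  shows "card {a \<in> players. vertex_at lam (spot a) v} = degree E v"
  unfolding players_at_vertex[OF assms] unfolding degree_def
  by (rule card_image) (auto intro: inj_onI)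

lemma vertex_crowd:
  assumes "\<not> leaf E v"
  shows "degree E v \<le> Suc (card {j \<in> {1..n} - {i}. vertex_at lam (x j) v})"
proof -
  have "degree E v = card {j \<in> {1..n}. vertex_at lam (x j) v}"
    unfolding x_def card_players_with[of "\<lambda>a. vertex_at lam (spot a) v"]
    using card_players_at_vertex[OF assms] by simp
  also have "\<dots> \<le> card (insert i {j \<in> {1..n} - {i}. vertex_at lam (x j) v})"
    by (rule card_mono) auto
  also have "\<dots> \<le> Suc (card {j \<in> {1..n} - {i}. vertex_at lam (x j) v})"
    by (rule card_insert_le_m1) auto
  finally show ?thesis .
qed

text \<open>Only an interior index can be left vacant. At an extreme index the other member of the
  pair stays if the end is a leaf; otherwise a second edge is incident with the vertex, and its
  player stands there too.\<close>

lemma other_at_pos: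
  assumes i: "i \<in> {1..n}" "\<phi> i = (e0, k0, b0)" and e: "e \<in> E" "k \<le> Suc (m e)"
    and ne: "\<not> (e = e0 \<and> k = k0 \<and> 1 \<le> k \<and> k \<le> m e)"
  shows "\<exists>j\<in>{1..n} - {i}. same_pt lam (x j) (e, pos e k)"
proof -
  have fin: ?thesis if "a \<in> players" "a \<noteq> \<phi> i" "same_pt lam (spot a) (e, pos e k)" for a
    using player_at[OF that(1)] that(2,3) by (metis Diff_iff singletonD x_def)
  have self: "same_pt lam p p" for p by (simp add: same_pt_def)
  show ?thesis
  proof (cases "(e, k) = (e0, k0)")
    case False
    then show ?thesis using fin[of "(e, k, False)"] e i self by (auto simp: players_iff spot_def)
  next
    case True
    define v where "v = (if k = 0 then fst e else snd e)"
    have k: "k = 0 \<or> k = Suc (m e)" using True ne e by auto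
    show ?thesis
    proof (cases "leaf E v")
      case leaf: True
      then show ?thesis
        using fin[of "(e, k, \<not> b0)"] e i k True self by (auto simp: players_iff spot_def v_def)
    next
      case nonleaf: False
      have ne': "fst e \<noteq> snd e" using e simple[of "fst e" "snd e"] by auto
      let ?I = "{e \<in> E. fst e = v \<or> snd e = v}"
      have "e \<in> ?I" using e by (auto simp: v_def)
      moreover have "?I \<noteq> {e}"
      proof
        assume "?I = {e}"
        then have "degree E v = card {e}" unfolding degree_def by (rule arg_cong)
        then show False using nonleaf by simp
      qed
      ultimately obtain f where f: "f \<in> ?I" "f \<noteq> e" by blast
      have "vertex_at lam (e, pos e k) v"
        using vertex_at_end[OF e(1), of v] nonleaf k ne' by (auto simp: v_def split: if_splits)
      moreover have "vertex_at lam (f, pos f (if fst f = v then 0 else Suc (m f))) v"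
        using vertex_at_end[of f v] f nonleaf by blast
      ultimately have
        "same_pt lam (spot (f, if fst f = v then 0 else Suc (m f), False)) (e, pos e k)"
        by (auto simp: spot_def same_pt_def)
      then show ?thesis
        using f i True by (intro fin[of "(f, if fst f = v then 0 else Suc (m f), False)"])
          (auto simp: players_iff)
    qed
  qed
qed

lemma gaps_le_others:
  assumes i: "i \<in> {1..n}" "\<phi> i = (e0, k0, b0)" and M: "G \<le> M"
    and M0: "1 \<le> k0 \<Longrightarrow> k0 \<le> m e0 \<Longrightarrow> pos e0 (Suc k0) \<le> pos e0 (k0 - 1) + M"
    and e: "e \<in> E"
  shows "gaps_le x ({1..n} - {i}) M e"
proof -
  have fst_end: "pos e 0 = 0 \<or> leaf E (fst e) \<and> pos e 0 \<le> M / 2"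
    using pos_0[OF e] M by (auto simp: margin_def)
  have snd_end: "pos e (Suc (m e)) = lam e \<or> leaf E (snd e) \<and> lam e - pos e (Suc (m e)) \<le> M / 2"
    using pos_last[of e] M by (auto simp: margin_def)
  have step: "pos e k \<le> pos e (Suc k) \<and> pos e (Suc k) \<le> pos e k + M" if "k \<le> m e" for k
    using pos_Suc_bounds[OF e that] M by linarith
  note occ = other_at_pos[OF i e]
  show ?thesis
  proof (cases "e = e0 \<and> 1 \<le> k0 \<and> k0 \<le> m e0")
    case False
    show ?thesis
      unfolding gaps_le_def
      by (rule exI[of _ "Suc (m e)"], rule exI[of _ "pos e"])
        (use step fst_end snd_end pos_bounds[OF e] occ False in auto)
  next
    case True
    \<comment> \<open>The chain skips the index \<open>k0\<close> and so has one step fewer. It is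
      skipped even if a neighbouring index has the same position.\<close>
    define p where "p k = pos e (if k < k0 then k else Suc k)" for k
    have "p k \<le> p (Suc k) \<and> p (Suc k) \<le> p k + M" if "k < m e" for k
    proof -
      consider "Suc k < k0" | "Suc k = k0" | "k0 \<le> k" by linarith
      then show ?thesis
      proof cases
        case 2
        then show ?thesis using M0 True step[of k] step[of "Suc k"] that by (auto simp: p_def)
      qed (use step[of k] step[of "Suc k"] that in \<open>auto simp: p_def\<close>)
    qed
    moreover have "0 \<le> p k \<and> p k \<le> lam e \<and> (\<exists>j\<in>{1..n} - {i}. same_pt lam (x j) (e, p k))"
      if "k \<le> m e" for k
      unfolding p_def using that by (intro conjI pos_bounds[OF e] occ) auto
    moreover have "p 0 = pos e 0" "p (m e) = pos e (Suc (m e))" using True by (auto simp: p_def)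
    ultimately show ?thesis
      unfolding gaps_le_def using fst_end snd_end
      by (intro exI[of _ "m e"] exI[of _ p]) auto
  qed
qed

lemma vertex_occupied:
  assumes "e \<in> E" "v \<in> {fst e, snd e}" "\<not> leaf E v"
  shows "\<exists>j\<in>{1..n}. vertex_at lam (x j) v"
proof -
  let ?a = "(e, if fst e = v then 0 else Suc (m e), False)"
  have "?a \<in> players" using assms by (simp add: players_iff)
  then obtain j where "j \<in> {1..n}" "\<phi> j = ?a" by (rule player_at)
  then show ?thesis
    using vertex_at_end[of e v] assms by (auto simp: x_def spot_def intro!: bexI[of _ j])
qed

section \<open>Lower bounds on payoffs in the profile\<close>

lemma edge_payoff_ge:
  assumes i: "i \<in> {1..n}" "\<phi> i = (e, k0, b)"
    and lr: "0 \<le> l" "l \<le> r" "r \<le> lam e"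
    and W: "card {a \<in> players. same_pt lam (spot (\<phi> i)) (spot a)} \<le> c"
    and near: "\<And>t k. t \<in> {l<..<r} \<Longrightarrow> k \<le> Suc (m e) \<Longrightarrow> pos e k \<noteq> pos e k0
        \<Longrightarrow> \<bar>pos e k0 - t\<bar> < \<bar>pos e k - t\<bar>"
  shows "(r - l) / real c \<le> payoff E lam n x i"
proof -
  have e: "e \<in> E" "k0 \<le> Suc (m e)" using \<phi>_players[OF i(1)] by (auto simp: i players_iff)
  let ?w = "card {a \<in> players. same_pt lam (spot (\<phi> i)) (spot a)}"
  have "\<phi> i \<in> {a \<in> players. same_pt lam (spot (\<phi> i)) (spot a)}"
    using \<phi>_players[OF i(1)] by (simp add: same_pt_def)
  then have w: "0 < ?w" 
    by (intro card_gt_0_iff[THEN iffD2] conjI) (blast, simp add: finite_players)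
  have xi: "x i = (e, pos e k0)" by (simp add: x_def spot_def i)
  have "(\<Sum>e\<in>{e}. r - l) / real (card {j \<in> {1..n}. same_pt lam (x i) (x j)}) \<le> payoff E lam n x i"
  proof (rule payoff_ge[where s = "\<lambda>_. pos e k0"])
    show "\<exists>j\<in>{1..n}. vertex_at lam (x j) v" if "e \<in> E" "v \<in> {fst e, snd e}" "\<not> leaf E v" for e v
      using that by (rule vertex_occupied)
    show "\<bar>pos e k0 - t\<bar> < \<bar>q - t\<bar>" if f: "f \<in> {e}" and t: "t \<in> {l<..<r}" and j: "j \<in> {1..n}"
      and q: "same_pt lam (x j) (f, q)" "q \<noteq> pos e k0" for f t j q
    proof -
      obtain k where "k \<le> Suc (m e)" "q = pos e k"
        using spot_on_edge[OF \<phi>_players[OF j] e(1)] f q(1) by (auto simp: x_def)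
      then show ?thesis using near t q(2) by blast
    qed
  qed (use x_netpts i e lr pos_bounds xi in \<open>auto simp: same_pt_def\<close>)
  then have "(r - l) / real ?w \<le> payoff E lam n x i"
    using card_colocated_players[OF i(1)] by simp
  moreover have "(r - l) / real c \<le> (r - l) / real ?w"
    using w W lr by (intro divide_left_mono) auto
  ultimately show ?thesis by linarith
qed

text \<open>Every incident edge has a full gap next to \<open>v\<close> and yields a stretch of
  length \<open>G / 2\<close>; the players at \<open>v\<close> are exactly as many as these
  edges.\<close>

lemma vertex_payoff_ge:
  assumes i: "i \<in> {1..n}" and v: "vertex_at lam (x i) v" "\<not> leaf E v"
  shows "G / 2 \<le> payoff E lam n x i"
proof -
  let ?F = "{e \<in> E. fst e = v \<or> snd e = v}"
  have deg: "card ?F = degree E v" by (simp add: degree_def)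
  have "{a \<in> players. same_pt lam (spot (\<phi> i)) (spot a)} \<subseteq> {a \<in> players. vertex_at lam (spot a) v}"
    using v vertex_at_unique[OF x_netpts[OF i]] unfolding same_pt_def x_def by fastforce
  then have "card {a \<in> players. same_pt lam (spot (\<phi> i)) (spot a)} \<le> card ?F"
    unfolding deg card_players_at_vertex[OF v(2), symmetric]
    by (rule card_mono[rotated]) (simp add: finite_players)
  then have W: "card {j \<in> {1..n}. same_pt lam (x i) (x j)} \<le> card ?F"
    using card_colocated_players[OF i] by simp
  have "i \<in> {j \<in> {1..n}. same_pt lam (x i) (x j)}" using i by (simp add: same_pt_def)
  then have W0: "0 < card {j \<in> {1..n}. same_pt lam (x i) (x j)}" by (auto simp: card_gt_0_iff)
  define s where "s e = pos e (if fst e = v then 0 else Suc (m e))" for e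
  \<comment> \<open>The vertex is at 0 or at \<open>lam e\<close>, depending on the orientation of
    \<open>e\<close>; the stretch ends in the middle of the adjacent full gap.\<close>
  define l where "l e = (if fst e = v then 0 else lam e - G / 2)" for e
  define r where "r e = (if fst e = v then G / 2 else lam e)" for e
  have s_eq: "s e = (if fst e = v then 0 else lam e)" if "e \<in> ?F" for e
    using that v(2) pos_0[of e] pos_last[of e] by (auto simp: s_def margin_def)
  have long: "G \<le> lam e" if "e \<in> E" for e
    using pos_1[OF that] pos_bounds(2)[OF that, of 1] margin_nonneg[of "fst e"] by simp
  have total: "(\<Sum>e\<in>?F. r e - l e) / real (card {j \<in> {1..n}. same_pt lam (x i) (x j)}) \<le> payoff E lam n x i"
  proof (rule payoff_ge[where s = s])
    show "\<exists>j\<in>{1..n}. vertex_at lam (x j) v" if "e \<in> E" "v \<in> {fst e, snd e}" "\<not> leaf E v" for e v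
      using that by (rule vertex_occupied)
    show "s e \<in> {0..lam e} \<and> same_pt lam (x i) (e, s e)" if "e \<in> ?F" for e
      using that vertex_at_end[of e v] v lam_pos[of e] pos_bounds[of e]
      by (auto simp: same_pt_def s_def)
    show "0 \<le> l e \<and> l e \<le> r e \<and> r e \<le> lam e" if "e \<in> ?F" for e
      using that long[of e] G_pos by (auto simp: l_def r_def)
    show "\<bar>s e - t\<bar> < \<bar>q - t\<bar>" if e: "e \<in> ?F" and t: "t \<in> {l e<..<r e}" and j: "j \<in> {1..n}"
      and q: "same_pt lam (x j) (e, q)" "q \<noteq> s e" for e t j q
    proof -
      have eE: "e \<in> E" using e by blast
      obtain k where k: "k \<le> Suc (m e)" "q = pos e k"
        using spot_on_edge[OF \<phi>_players[OF j] eE] q(1) by (auto simp: x_def)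
      show ?thesis
      proof (cases "fst e = v")
        case True
        then have "k \<noteq> 0" using k(2) q(2) by (cases k) (auto simp: s_def)
        then have "pos e 1 \<le> q" using k eE by (auto intro!: pos_mono)
        then show ?thesis
          using t True s_eq[OF e] pos_1[OF eE] margin_nonneg[of "fst e"] G_pos q(2)
          by (intro dist_less_left[of G]) (auto simp: r_def)
      next
        case False
        then have "k \<noteq> Suc (m e)" using k q by (auto simp: s_def)
        then have "q \<le> pos e (m e)" using k eE by (auto intro!: pos_mono)
        then show ?thesis
          using t False s_eq[OF e] pos_m[of e] margin_nonneg[of "snd e"] G_pos q(2)
          by (intro dist_less_right[of _ "lam e - G"]) (auto simp: l_def field_simps)
      qed
    qed
  qed (use x_netpts i in auto)
  have sum_eq: "(\<Sum>e\<in>?F. r e - l e) = real (card ?F) * (G / 2)"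
  proof -
    have "r e - l e = G / 2" for e by (simp add: r_def l_def)
    then have "(\<Sum>e\<in>?F. r e - l e) = (\<Sum>e\<in>?F. G / 2)" by (rule sum.cong[OF refl])
    then show ?thesis by simp
  qed
  have "G / 2 \<le> real (card ?F) * (G / 2) / real (card {j \<in> {1..n}. same_pt lam (x i) (x j)})"
    using W W0 G_pos by (simp add: field_simps)
  then show ?thesis using total unfolding sum_eq by (rule order_trans)
qed

text \<open>Stated for a block of coinciding indices strictly between \<open>kl\<close> and
  \<open>kr\<close>, so that it covers a lone player (\<open>kr - kl - 1\<close> is 1) and the pair
  formed when the short gap is 0 (it is 2). The territory lies between the two midpoints.\<close>

lemma interior_payoff_ge:
  assumes i: "i \<in> {1..n}" "\<phi> i = (e, k0, b)" and k: "kl < k0" "k0 < kr" "kr \<le> Suc (m e)"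
    and eq: "\<And>k. kl < k \<Longrightarrow> k < kr \<Longrightarrow> pos e k = pos e k0"
    and strict: "pos e kl < pos e k0" "pos e k0 < pos e kr"
  shows "(pos e kr - pos e kl) / 2 / real (kr - kl - 1) \<le> payoff E lam n x i"
proof -
  have e: "e \<in> E" "k0 \<le> Suc (m e)" using \<phi>_players[OF i(1)] by (auto simp: i players_iff)
  have nv: "\<not> vertex_at lam (spot (\<phi> i)) v" for v
    using vertex_at_pos(2)[OF e, of v] k by (auto simp: i spot_def)
  have low: "pos e k \<le> pos e kl" if "k \<le> kl" for k using that k e by (intro pos_mono) auto
  have high: "pos e kr \<le> pos e k" if "kr \<le> k" "k \<le> Suc (m e)" for k using that k e by (intro pos_mono) auto
  have "{a \<in> players. same_pt lam (spot (\<phi> i)) (spot a)} \<subseteq> (\<lambda>k. (e, k, False)) ` {kl<..<kr}"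
  proof
    fix a assume a: "a \<in> {a \<in> players. same_pt lam (spot (\<phi> i)) (spot a)}"
    obtain e' k b' where a_eq: "a = (e', k, b')" by (metis surj_pair)
    have "spot (\<phi> i) = spot a" using a nv by (auto simp: same_pt_def)
    then have ee: "e' = e" "pos e k = pos e k0" by (auto simp: a_eq i spot_def)
    have kb: "k \<le> Suc (m e)" "b' \<longrightarrow> k = 0 \<or> k = Suc (m e)" using a ee by (auto simp: a_eq players_iff)
    have "kl < k" "k < kr" using low[of k] high[of k] strict ee kb by (force simp: not_less)+
    then show "a \<in> (\<lambda>k. (e, k, False)) ` {kl<..<kr}" using kb k ee by (auto simp: a_eq)
  qed
  then have "card {a \<in> players. same_pt lam (spot (\<phi> i)) (spot a)} \<le> card ((\<lambda>k. (e, k, False)) ` {kl<..<kr})"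
    by (intro card_mono) auto
  also have "\<dots> \<le> kr - kl - 1" using card_image_le[of "{kl<..<kr}"] by fastforce
  finally have W: "card {a \<in> players. same_pt lam (spot (\<phi> i)) (spot a)} \<le> kr - kl - 1" .
  have "((pos e k0 + pos e kr) / 2 - (pos e kl + pos e k0) / 2) / real (kr - kl - 1) \<le> payoff E lam n x i"
  proof (rule edge_payoff_ge[OF i _ _ _ W])
    fix t k assume t: "t \<in> {(pos e kl + pos e k0) / 2<..<(pos e k0 + pos e kr) / 2}"
      and k': "k \<le> Suc (m e)" "pos e k \<noteq> pos e k0"
    have "k \<le> kl \<or> kr \<le> k" using eq[of k] k'(2) by linarith
    then show "\<bar>pos e k0 - t\<bar> < \<bar>pos e k - t\<bar>"
      using t k' strict low[of k] high[of k]
        dist_less_right[of "pos e k" "pos e kl" "pos e k0" t]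
        dist_less_left[of "pos e kr" "pos e k" "pos e k0" t] by auto
  qed (use strict pos_bounds[OF e(1), of k0] pos_bounds[OF e(1), of kl] pos_bounds[OF e(1), of kr] k in auto)
  moreover have "(pos e k0 + pos e kr) / 2 - (pos e kl + pos e k0) / 2 = (pos e kr - pos e kl) / 2"
    by (simp add: field_simps)
  ultimately show ?thesis by simp
qed

text \<open>The pair stands at distance \<open>G / 2\<close> from the leaf and the next position is
  at \<open>3 * G / 2\<close>, with midpoint \<open>G\<close>: the two players share a stretch of
  length \<open>G\<close>.\<close>

lemma leaf_payoff_ge:
  assumes i: "i \<in> {1..n}" "\<phi> i = (e, k0, b)"
    and lf: "k0 = 0 \<and> leaf E (fst e) \<or> k0 = Suc (m e) \<and> leaf E (snd e)"
  shows "G / 2 \<le> payoff E lam n x i"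
proof -
  have e: "e \<in> E" "k0 \<le> Suc (m e)" using \<phi>_players[OF i(1)] by (auto simp: i players_iff)
  have nv: "\<not> vertex_at lam (spot (\<phi> i)) v" for v
    using vertex_at_pos[OF e, of v] lf by (auto simp: i spot_def)
  have pos_eq: "k = k0" if "k \<le> Suc (m e)" "pos e k = pos e k0" for k
  proof (rule ccontr)
    assume "k \<noteq> k0"
    moreover have "pos e 1 \<le> pos e k" if "k \<noteq> 0"
      using that \<open>k \<le> Suc (m e)\<close> e by (intro pos_mono) auto
    moreover have "pos e k \<le> pos e (m e)" if "k \<noteq> Suc (m e)"
      using that \<open>k \<le> Suc (m e)\<close> e by (intro pos_mono) auto
    ultimately show False
      using lf that pos_1[OF e(1)] pos_0[OF e(1)] pos_m[of e] pos_last[of e] G_pos by auto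
  qed
  have "{a \<in> players. same_pt lam (spot (\<phi> i)) (spot a)} \<subseteq> {(e, k0, False), (e, k0, True)}"
  proof
    fix a assume a: "a \<in> {a \<in> players. same_pt lam (spot (\<phi> i)) (spot a)}"
    obtain e' k b' where a_eq: "a = (e', k, b')" by (metis surj_pair)
    have "spot (\<phi> i) = spot a" using a nv by (auto simp: same_pt_def)
    then have ee: "e' = e" "pos e k = pos e k0" by (auto simp: a_eq i spot_def)
    then have "k = k0" using a pos_eq by (auto simp: a_eq players_iff)
    then show "a \<in> {(e, k0, False), (e, k0, True)}" using ee by (auto simp: a_eq)
  qed
  then have "card {a \<in> players. same_pt lam (spot (\<phi> i)) (spot a)} \<le> card {(e, k0, False), (e, k0, True)}"
    by (intro card_mono) auto
  then have W: "card {a \<in> players. same_pt lam (spot (\<phi> i)) (spot a)} \<le> 2" by simp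
  have fit1: "pos e 1 \<le> lam e" and fit2: "0 \<le> pos e (m e)"
    using pos_bounds[OF e(1)] by auto
  from lf show ?thesis
  proof
    assume k0: "k0 = 0 \<and> leaf E (fst e)"
    then have mg: "margin (fst e) = G / 2" by (simp add: margin_def)
    have "(G - 0) / real 2 \<le> payoff E lam n x i"
    proof (rule edge_payoff_ge[OF i _ _ _ W])
      fix t k assume t: "t \<in> {0<..<G}" and k: "k \<le> Suc (m e)" "pos e k \<noteq> pos e k0"
      then have "k \<noteq> 0" using k0 by metis
      then have "pos e 1 \<le> pos e k" using e k by (auto intro!: pos_mono)
      then show "\<bar>pos e k0 - t\<bar> < \<bar>pos e k - t\<bar>"
        using t k k0 pos_1[OF e(1)] pos_0[OF e(1)] mg G_pos
        by (intro dist_less_left[of "pos e 1"]) auto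
    qed (use fit1 pos_1[OF e(1)] margin_nonneg[of "fst e"] G_pos in auto)
    then show ?thesis by simp
  next
    assume k0: "k0 = Suc (m e) \<and> leaf E (snd e)"
    then have mg: "margin (snd e) = G / 2" by (simp add: margin_def)
    have "(lam e - (lam e - G)) / real 2 \<le> payoff E lam n x i"
    proof (rule edge_payoff_ge[OF i _ _ _ W])
      fix t k assume t: "t \<in> {lam e - G<..<lam e}" and k: "k \<le> Suc (m e)" "pos e k \<noteq> pos e k0"
      then have "k \<noteq> Suc (m e)" using k0 by metis
      then have "pos e k \<le> pos e (m e)" using e k by (auto intro!: pos_mono)
      then show "\<bar>pos e k0 - t\<bar> < \<bar>pos e k - t\<bar>"
        using t k k0 pos_m[of e] pos_last[of e] mg G_pos
        by (intro dist_less_right[of _ "pos e (m e)"]) auto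
    qed (use fit2 pos_m[of e] margin_nonneg[of "snd e"] G_pos in auto)
    then show ?thesis by simp
  qed
qed

text \<open>For an interior index \<open>M\<close> is the distance between its two neighbours, at
  least \<open>G\<close> because one adjacent gap is always full. A member of a coinciding pair has
  her partner as a neighbour, so there \<open>M = G\<close>, which matches her half of a territory
  of length \<open>G\<close>.\<close>

lemma payoff_ge_half_gap:
  assumes i: "i \<in> {1..n}" "\<phi> i = (e, k0, b)"
  obtains M where "G \<le> M" "M / 2 \<le> payoff E lam n x i"
    "1 \<le> k0 \<Longrightarrow> k0 \<le> m e \<Longrightarrow> pos e (Suc k0) \<le> pos e (k0 - 1) + M"
proof -
  have e: "e \<in> E" "k0 \<le> Suc (m e)" using \<phi>_players[OF i(1)] by (auto simp: i players_iff)
  have m2: "2 \<le> m e" using m_ge[OF e(1)] .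
  show thesis
  proof (cases "1 \<le> k0 \<and> k0 \<le> m e")
    case True
    then obtain k1 where k1: "k0 = Suc k1" by (cases k0) auto
    have up: "pos e (Suc k0) = pos e k0 + (if Suc k0 = m e then rest e else G)"
      using pos_Suc[OF e(1), of k0] True by simp
    have down: "pos e k0 = pos e k1 + (if k0 = m e then rest e else G)"
      using pos_Suc[OF e(1), of k1] True k1 by simp
    define M where "M = pos e (Suc k0) - pos e (k0 - 1)"
    have GM: "G \<le> M" using up down rest[OF e(1)] by (auto simp: M_def k1)
    have "M / 2 \<le> payoff E lam n x i"
    proof (cases "rest e = 0 \<and> (k0 = m e \<or> Suc k0 = m e)")
      case False
      then have st: "pos e k1 < pos e k0" "pos e k0 < pos e (Suc k0)"
        using up down rest[OF e(1)] G_pos by auto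
      have "(pos e (Suc k0) - pos e k1) / 2 / real (Suc k0 - k1 - 1) \<le> payoff E lam n x i"
        by (rule interior_payoff_ge[OF i]) (use st k1 True in \<open>auto simp: less_Suc_eq\<close>)
      then show ?thesis by (simp add: M_def k1)
    next
      case pair: True
      \<comment> \<open>The pair has the indices \<open>m e - 1\<close> and \<open>m e\<close>; its
        outer neighbours are \<open>a\<close> and \<open>m e + 1\<close>.\<close>
      define a where "a = m e - 2"
      have a: "m e = Suc (Suc a)" using m2 by (simp add: a_def)
      have p1: "pos e (Suc a) = pos e a + G" using pos_Suc[OF e(1), of a] a by simp
      have p2: "pos e (Suc (Suc a)) = pos e (Suc a)" using pos_Suc[OF e(1), of "Suc a"] a pair by simp
      have p3: "pos e (Suc (Suc (Suc a))) = pos e (Suc (Suc a)) + G"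
        using pos_Suc[OF e(1), of "Suc (Suc a)"] a by simp
      have k0: "k0 = Suc a \<or> k0 = Suc (Suc a)" using pair a by auto
      have "(pos e (Suc (Suc (Suc a))) - pos e a) / 2 / real (Suc (Suc (Suc a)) - a - 1)
          \<le> payoff E lam n x i"
        by (rule interior_payoff_ge[OF i])
          (use k0 a p1 p2 p3 G_pos in \<open>auto simp: less_Suc_eq\<close>)
      moreover have "M = G" using k0 p1 p2 p3 by (auto simp: M_def)
      ultimately show ?thesis using p1 p2 p3 by simp
    qed
    then show ?thesis using that[OF GM] by (simp add: M_def)
  next
    case False
    then have k: "k0 = 0 \<or> k0 = Suc (m e)" using e by auto
    define v where "v = (if k0 = 0 then fst e else snd e)"
    have ne: "fst e \<noteq> snd e" using e simple[of "fst e" "snd e"] by auto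
    have "G / 2 \<le> payoff E lam n x i"
    proof (cases "leaf E v")
      case True
      then show ?thesis using leaf_payoff_ge[OF i] k by (auto simp: v_def split: if_splits)
    next
      case nonleaf: False
      have "vertex_at lam (x i) v"
        using vertex_at_end[OF e(1), of v] nonleaf k ne
        by (auto simp: v_def x_def spot_def i split: if_splits)
      then show ?thesis using vertex_payoff_ge[OF i(1)] nonleaf by blast
    qed
    then show ?thesis using that[of G] False by auto
  qed
qed

lemma nash: "nash_eq E lam n x"
  unfolding nash_eq_def
proof (intro conjI ballI)
  fix i y assume i: "i \<in> {1..n}" and y: "y \<in> netpts E lam"
  obtain e k b where \<phi>: "\<phi> i = (e, k, b)" by (metis surj_pair)
  obtain M where M: "G \<le> M" "M / 2 \<le> payoff E lam n x i"
    "1 \<le> k \<Longrightarrow> k \<le> m e \<Longrightarrow> pos e (Suc k) \<le> pos e (k - 1) + M"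
    using payoff_ge_half_gap[OF i \<phi>] by blast
  have "payoff E lam n (x(i := y)) i \<le> M / 2"
    by (rule deviation_payoff_le)
      (use x_netpts y i M G_pos gaps_le_others[OF i \<phi> M(1,3)] vertex_crowd in auto)
  then show "payoff E lam n (x(i := y)) i \<le> payoff E lam n x i" using M by linarith
qed (rule x_netpts)

end

section \<open>Initial gap size and the count of players\<close>

theorem mainTheorem1:
  fixes V :: "'v set" and E :: "('v \<times> 'v) set" and lam :: "'v \<times> 'v \<Rightarrow> real" and n :: nat
  assumes "finite V"
    and "E \<subseteq> V \<times> V"
    and "E \<noteq> {}"
    and "\<forall>(a, b) \<in> E. a \<noteq> b \<and> (b, a) \<notin> E"
    and "connected_graph V E"
    and "\<forall>v \<in> V. degree E v \<noteq> 2"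
    and "\<forall>e \<in> E. lam e > 0"
    and "int n \<ge> 3 * int (card E) + (\<Sum>e \<in> E. \<lceil>5 * lam e / Min (lam ` E)\<rceil>)"
  shows "\<exists>x. nash_eq E lam n x"
proof -
  interpret network V E lam
    by unfold_locales (use assms in auto)
  define L where "L = Min (lam ` E)"
  define c :: "'v \<times> 'v \<Rightarrow> nat" where "c e = of_bool (leaf E (fst e)) + of_bool (leaf E (snd e))" for e
  have L: "0 < L" "\<And>e. e \<in> E \<Longrightarrow> L \<le> lam e"
    using Min_lam assms(3) unfolding L_def by blast+
  have c2: "c e \<le> 2" for e by (simp add: c_def)
  \<comment> \<open>The initial gap size is \<open>L / 5\<close>; \<open>f e\<close> is the room on
    \<open>e\<close> in this unit after half a unit has been reserved at each leaf end. Since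
    \<open>lam e\<close> is at least \<open>L\<close> and \<open>c e\<close> at most 2, at least 5 -
    1 = 4 units remain. This gives \<open>m e\<close> at least 3, which covers the 2 required of
    \<open>spaced_network\<close>.\<close>
  define f where "f e = lam e * (5 / L) - real (c e) / 2" for e
  \<comment> \<open>The least count for which the short gap does not exceed a full one;
    \<open>nat\<close> truncates nothing, because \<open>f e\<close> is at least 4.\<close>
  define m where "m e = nat (\<lceil>f e\<rceil> - 1)" for e
  have f_ge: "4 \<le> f e" if "e \<in> E" for e
  proof -
    have "5 \<le> lam e * (5 / L)" using L that by (simp add: field_simps)
    then show ?thesis using c2[of e] unfolding f_def by linarith
  qed
  have m_int: "int (m e) = \<lceil>f e\<rceil> - 1" if "e \<in> E" for e
    using f_ge[OF that] unfolding m_def by (simp add: le_ceiling_iff)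
  have m_ge: "2 \<le> m e" if "e \<in> E" for e
  proof -
    have "4 \<le> \<lceil>f e\<rceil>" using f_ge[OF that] by (simp add: le_ceiling_iff)
    then show ?thesis using m_int[OF that] by linarith
  qed
  have m_real: "real (m e) = of_int \<lceil>f e\<rceil> - 1" if "e \<in> E" for e
    using m_int[OF that] by (metis of_int_1 of_int_diff of_int_of_nat_eq)
  have fit: "real (m e) \<le> f e \<and> f e \<le> real (m e) + 1" if "e \<in> E" for e
    using m_real[OF that] ceiling_correct[of "f e"] by linarith
  have "(\<Sum>e\<in>E. int (m e + 2 + c e)) \<le> (\<Sum>e\<in>E. 3 + \<lceil>5 * lam e / L\<rceil>)"
  proof (rule sum_mono)
    fix e assume e: "e \<in> E"
    have "\<lceil>f e\<rceil> \<le> \<lceil>5 * lam e / L\<rceil>"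
      by (rule ceiling_mono) (simp add: f_def mult.commute)
    \<comment> \<open>\<open>m e\<close> is at most the ceiling minus 1, the \<open>m e + 1\<close>
      gaps need \<open>m e + 2\<close> players, and leaf ends add at most 2 copies: this is the 3
      per edge in the bound.\<close>
    then show "int (m e + 2 + c e) \<le> 3 + \<lceil>5 * lam e / L\<rceil>"
      using m_int[OF e] c2[of e] by simp
  qed
  also have "\<dots> \<le> int n"
    using assms(8) by (simp add: sum.distrib L_def)
  finally have "(\<Sum>e\<in>E. m e + 2 + c e) \<le> n"
    by (metis of_nat_le_iff of_nat_sum)
  then have count: "sum m E + (\<Sum>e\<in>E. 2 + c e) \<le> n"
    by (simp only: sum.distrib add.assoc)
  then have "sum m E \<le> n - (\<Sum>e\<in>E. 2 + c e)" by simp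
  \<comment> \<open>Surplus players are absorbed by shrinking the gaps. The counts must sum to
    \<open>n\<close> minus the \<open>2 + c e\<close> players that each edge carries whatever its
    count.\<close>
  from spacing_exists[OF finite_E assms(3) lam_pos _ fit[unfolded f_def] this]
  obtain z m' where z: "0 < z" "sum m' E = n - (\<Sum>e\<in>E. 2 + c e)"
    and m': "\<And>e. e \<in> E \<Longrightarrow> m e \<le> m' e \<and> real (m' e) \<le> lam e * z - real (c e) / 2 \<and>
      lam e * z - real (c e) / 2 \<le> real (m' e) + 1"
    using L(1) by auto
  interpret spaced_network V E lam "1 / z" m'
  proof unfold_locales
    fix e assume e: "e \<in> E"
    show "2 \<le> m' e" using m'[OF e] m_ge[OF e] by linarith
    have eq: "lam e - real (c e) * (1 / z / 2) = (lam e * z - real (c e) / 2) * (1 / z)"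
      using z(1) by (simp add: field_simps)
    show "real (m' e) * (1 / z) \<le> lam e - real (of_bool (leaf E (fst e)) + of_bool (leaf E (snd e))) * (1 / z / 2)"
      "lam e - real (of_bool (leaf E (fst e)) + of_bool (leaf E (snd e))) * (1 / z / 2) \<le> (real (m' e) + 1) * (1 / z)"
      using m'[OF e] z(1) unfolding c_def[symmetric] eq by (auto intro!: divide_right_mono)
  qed (use z in simp)
  have "card players = sum m' E + (\<Sum>e\<in>E. 2 + c e)"
    unfolding card_players c_def by (simp only: sum.distrib add.assoc)
  then have "card players = n" using z(2) count by simp
  then obtain \<phi> where "bij_betw \<phi> {1..n} players"
    using ex_bij_betw_nat_finite_1[OF finite_players] by blast
  then interpret spaced_profile V E lam "1 / z" m' n \<phi>
    by unfold_locales
  show ?thesis using nash by blast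
qed

end
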